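(* Every infinite planar $2$-group is abelian.
   Context: A $2$-group is a group in which every element has order a power of $2$. For a group $G$, the subgroup graph $\mathcal{L}(G)$ is the graph whose vertices are all subgroups of $G$, two subgroups $H,K$ being adjacent if one of them is a maximal subgroup of the other. $G$ is planar if $\mathcal{L}(G)$ is a planar graph. *)

theory Defs
  imports "HOL-Analysis.Analysis" "HOL-Algebra.Algebra"
begin

definition two_group :: "('a, 'b) monoid_scheme \<Rightarrow> bool" where
  "two_group G \<longleftrightarrow> (\<forall>x\<in>carrier G. \<exists>n::nat. group.ord G x = 2 ^ n)"

definition maximal_subgroup_of ::
  "('a, 'b) monoid_scheme \<Rightarrow> 'a set \<Rightarrow> 'a set \<Rightarrow> bool" where
  "maximal_subgroup_of G H K \<longleftrightarrow>
     subgroup H G \<and> subgroup K G \<and> H \<subset> K \<and>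
     \<not> (\<exists>L. subgroup L G \<and> H \<subset> L \<and> L \<subset> K)"

definition subgroup_graph_adj ::
  "('a, 'b) monoid_scheme \<Rightarrow> 'a set \<Rightarrow> 'a set \<Rightarrow> bool" where
  "subgroup_graph_adj G H K \<longleftrightarrow> maximal_subgroup_of G H K \<or> maximal_subgroup_of G K H"

definition planar_graph :: "'v set \<Rightarrow> ('v \<Rightarrow> 'v \<Rightarrow> bool) \<Rightarrow> bool" where
  "planar_graph V E \<longleftrightarrow>
    (\<exists>(p :: 'v \<Rightarrow> real^2) (c :: 'v \<Rightarrow> 'v \<Rightarrow> real \<Rightarrow> real^2).
       inj_on p V \<and>
       (\<forall>u\<in>V. \<forall>v\<in>V. E u v \<longrightarrow>
          arc (c u v) \<and> pathstart (c u v) = p u \<and> pathfinish (c u v) = p v \<and>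
          path_image (c u v) \<inter> p ` V = {p u, p v} \<and>
          c v u = reversepath (c u v)) \<and>
       (\<forall>u\<in>V. \<forall>v\<in>V. \<forall>u'\<in>V. \<forall>v'\<in>V.
          E u v \<and> E u' v' \<and> {u, v} \<noteq> {u', v'} \<longrightarrow>
          path_image (c u v) \<inter> path_image (c u' v') \<subseteq> {p u, p v} \<inter> {p u', p v'}))"

definition planar_group :: "('a, 'b) monoid_scheme \<Rightarrow> bool" where
  "planar_group G \<longleftrightarrow> planar_graph {H. subgroup H G} (subgroup_graph_adj G)"

end

theory Submission
  imports Defs
begin

text \<open>
  The only topological input is that $K_{3,3}$ is not planar. It shows that a planar group contains
  neither $Z_4 \times Z_4$ nor an involution $z$ lying in three four-groups that are contained in
  one finite subgroup, nor an involution lying in four four-groups any two of which generate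
  a finite group.

  In a planar 2-group every involution thus commutes with only finitely many involutions. Two
  non-commuting involutions both commute with a third one, so the group has finitely many
  involutions. Planarity passes to $C(y)/\langle y\rangle$, so every $y$ has only finitely many
  square roots. If the group is infinite, Koenig's lemma yields a quasicyclic subgroup $P$, and $P$
  is central because every element has finitely many conjugates.

  Modulo $P$ there is at most one involution: two of them would produce a commuting pair, and
  with its product three four-groups on the involution of $P$ inside one finite subgroup. Finally
  an element of order 4 modulo $P$ would give $Z_4 \times Z_4$, so $G$ is $P$ or $P \times Z_2$.
\<close>

section \<open>Theta curves in the plane\<close>

text \<open>Edges of the subgroup graph are covering relations, and in an infinite group two nested
  subgroups need not be joined by a finite chain of them. This obstacle shapes every nonplanar
  configuration: the third branch vertex opposite the three \<open>v i\<close> is not a single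
  subgroup but a connected cluster of larger ones, held together by maximal chains inside finite
  subgroups. Hence the finiteness clauses in the overview, and hence the role of involutions: two of
  them generate a dihedral group, which is finite as soon as their product has finite order. The
  other two branch vertices are small: the trivial group and the group of order 2 on
  \<open>z\<close> for the four-groups, the trivial group and the four-group of squares for Z_4 x
  Z_4. Nonplanarity of K_{3,3} itself comes from deleting the cluster: a theta curve remains, and no
  component of its complement adheres to the interiors of all three arcs.\<close>

lemma theta_face:
  fixes g1 g2 g3 :: "real \<Rightarrow> complex"
  assumes arcs: "arc g1" "arc g2" "arc g3"
    and ends: "pathstart g1 = a" "pathfinish g1 = b" "pathstart g2 = a" "pathfinish g2 = b"
      "pathstart g3 = a" "pathfinish g3 = b"
    and int: "path_image g1 \<inter> path_image g2 = {a, b}" "path_image g1 \<inter> path_image g3 = {a, b}"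
      "path_image g2 \<inter> path_image g3 = {a, b}"
  obtains D E where "connected D" "connected E" "E \<noteq> {}" "D \<inter> E = {}"
    "D \<union> E = - (path_image g1 \<union> path_image g2)"
    "frontier E = path_image g1 \<union> path_image g2"
    "E \<inter> path_image g3 = {}"
proof -
  define c where "c = g1 +++ reversepath g2"
  have c: "simple_path c" "pathfinish c = pathstart c"
    using arcs ends int by (auto simp: c_def simple_path_join_loop_eq arc_reversepath)
  have pc: "path_image c = path_image g1 \<union> path_image g2"
    using ends by (simp add: c_def path_image_join)
  define I where "I = inside (path_image c)"
  define U where "U = outside (path_image c)"
  have IU: "I \<noteq> {}" "connected I" "U \<noteq> {}" "connected U" "open I" "open U" "I \<inter> U = {}"
    "I \<union> U = - path_image c" "frontier I = path_image c" "frontier U = path_image c"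
    using Jordan_inside_outside[OF c] by (auto simp: I_def U_def)
  let ?M = "path_image g3 - {a, b}"
  have con: "connected ?M"
    using connected_simple_path_endless[of g3] arcs ends by (simp add: arc_imp_simple_path)
  have sub: "?M \<subseteq> I \<union> U"
    using IU(8) int pc by auto
  have ab: "a \<in> path_image c" "b \<in> path_image c"
    using ends pc pathstart_in_path_image by blast+
  \<comment> \<open>The third arc without its ends is connected and misses the Jordan curve, so it
    stays on one side; the other side becomes \<open>E\<close>.\<close>
  have "I \<inter> ?M = {} \<or> U \<inter> ?M = {}"
    using connectedD[OF con IU(5,6)] sub IU(7) by blast
  then have "I \<inter> path_image g3 = {} \<or> U \<inter> path_image g3 = {}"
    using ab IU(8) by blast
  then show ?thesis
  proof
    assume "I \<inter> path_image g3 = {}"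
    then show ?thesis using that[of U I] IU pc by auto
  next
    assume "U \<inter> path_image g3 = {}"
    then show ?thesis using that[of I U] IU pc by auto
  qed
qed

text \<open>Each of the three closed curves of a theta graph bounds a face that misses the remaining arc.
  If a further face existed, one of these three faces would be separated from it by exactly one of
  the curves, against Janiszewski's theorem for the other two.\<close>

lemma theta_component_misses_arc:
  fixes g1 g2 g3 :: "real \<Rightarrow> complex"
  assumes arcs: "arc g1" "arc g2" "arc g3"
    and ends: "pathstart g1 = a" "pathfinish g1 = b" "pathstart g2 = a" "pathfinish g2 = b"
      "pathstart g3 = a" "pathfinish g3 = b"
    and int: "path_image g1 \<inter> path_image g2 = {a, b}" "path_image g1 \<inter> path_image g3 = {a, b}"
      "path_image g2 \<inter> path_image g3 = {a, b}"
    and p: "p \<notin> path_image g1 \<union> path_image g2 \<union> path_image g3"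
    and R: "R = connected_component_set (- (path_image g1 \<union> path_image g2 \<union> path_image g3)) p"
  shows "\<exists>g\<in>{g1, g2, g3}. closure R \<inter> (path_image g - {a, b}) = {}"
proof -
  let ?P1 = "path_image g1" and ?P2 = "path_image g2" and ?P3 = "path_image g3"
  let ?T = "?P1 \<union> ?P2 \<union> ?P3"
  obtain D3 E3 where 3: "connected D3" "connected E3" "E3 \<noteq> {}" "D3 \<inter> E3 = {}"
    "D3 \<union> E3 = - (?P1 \<union> ?P2)" "frontier E3 = ?P1 \<union> ?P2" "E3 \<inter> ?P3 = {}"
    by (rule theta_face[OF arcs ends int])
  obtain D2 E2 where 2: "connected D2" "connected E2" "E2 \<noteq> {}" "D2 \<inter> E2 = {}"
    "D2 \<union> E2 = - (?P1 \<union> ?P3)" "frontier E2 = ?P1 \<union> ?P3" "E2 \<inter> ?P2 = {}"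
    by (rule theta_face[OF arcs(1,3,2) ends(1,2,5,6,3,4)]) (use int in blast)+
  obtain D1 E1 where 1: "connected D1" "connected E1" "E1 \<noteq> {}" "D1 \<inter> E1 = {}"
    "D1 \<union> E1 = - (?P2 \<union> ?P3)" "frontier E1 = ?P2 \<union> ?P3" "E1 \<inter> ?P1 = {}"
    by (rule theta_face[OF arcs(2,3,1) ends(3,4,5,6,1,2)]) (use int in blast)+
  \<comment> \<open>\<open>R\<close> avoids the theta graph, which contains the frontier of
    \<open>E\<close>, so it cannot leave \<open>E\<close>. Closing up adds only frontier points, and
    these miss the open arc.\<close>
  have face: "closure R \<inter> (path_image g - {a, b}) = {}"
    if E: "connected E" "p \<in> E" "E \<inter> ?T = {}" "frontier E \<subseteq> ?T"
      "frontier E \<inter> (path_image g - {a, b}) = {}" "g \<in> {g1, g2, g3}" for E g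
  proof -
    have "R \<subseteq> E"
    proof (rule ccontr)
      assume "\<not> R \<subseteq> E"
      moreover have "connected R" "p \<in> R" using R p by auto
      ultimately have "R \<inter> frontier E \<noteq> {}"
        using connected_Int_frontier[of R E] E(2) by blast
      then show False using E(4) R connected_component_subset by blast
    qed
    then have "closure R \<subseteq> E \<union> frontier E"
      using closure_mono[of R E] closure_Un_frontier[of E] by auto
    then show ?thesis using E by blast
  qed
  have ne: "?P1 - {a, b} \<noteq> {}" "?P2 - {a, b} \<noteq> {}" "?P3 - {a, b} \<noteq> {}"
    using nonempty_simple_path_endless arcs ends arc_imp_simple_path by metis+
  show ?thesis
  proof (cases "p \<in> E1 \<or> p \<in> E2 \<or> p \<in> E3")
    case True
    then show ?thesis
    proof (elim disjE)
      assume "p \<in> E1"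
      then have "closure R \<inter> (?P1 - {a, b}) = {}"
        using 1 int by (intro face[of E1]) auto
      then show ?thesis by blast
    next
      assume "p \<in> E2"
      then have "closure R \<inter> (?P2 - {a, b}) = {}"
        using 2 int by (intro face[of E2]) auto
      then show ?thesis by blast
    next
      assume "p \<in> E3"
      then have "closure R \<inter> (?P3 - {a, b}) = {}"
        using 3 int by (intro face[of E3]) auto
      then show ?thesis by blast
    qed
  next
    case False
    \<comment> \<open>Connected sets that meet and miss each other's frontiers contain one another,
      hence coincide; unequal frontiers rule this out.\<close>
    have disj: "E \<inter> F = {}"
      if "connected E" "connected F" "E \<inter> frontier F = {}" "F \<inter> frontier E = {}"
        "frontier E \<noteq> frontier F" for E F :: "complex set"
    proof (rule ccontr)
      assume "E \<inter> F \<noteq> {}"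
      then have "E \<subseteq> F" "F \<subseteq> E"
        using connected_Int_frontier[of E F] connected_Int_frontier[of F E] that by blast+
      then show False using that by auto
    qed
    have "E1 \<inter> frontier E2 = {}" "E2 \<inter> frontier E1 = {}"
      "E1 \<inter> frontier E3 = {}" "E3 \<inter> frontier E1 = {}"
      unfolding 1(6) 2(6) 3(6) using 1(5,7) 2(5,7) 3(5,7) by blast+
    moreover have "frontier E1 \<noteq> frontier E2" "frontier E1 \<noteq> frontier E3"
      unfolding 1(6) 2(6) 3(6) using ne(1) int by blast+
    ultimately have "E1 \<inter> E2 = {}" "E1 \<inter> E3 = {}"
      using 1(2) 2(2) 3(2) by (simp_all add: disj)
    \<comment> \<open>Both \<open>q\<close> and \<open>p\<close> lie outside \<open>E2\<close> and
      \<open>E3\<close>, so \<open>D2\<close> and \<open>D3\<close> connect them off each of the two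
      curves through \<open>g1\<close>. Only the curve bounding \<open>E1\<close> separates
      them.\<close>
    moreover obtain q where q: "q \<in> E1" using 1 by blast
    ultimately have q': "q \<in> D2" "q \<in> D3" "p \<in> D1" "p \<in> D2" "p \<in> D3"
      using False p 1(5,7) 2(5) 3(5) by blast+
    have "connected_component (- ((?P1 \<union> ?P3) \<union> (?P1 \<union> ?P2))) p q"
    proof (rule Janiszewski)
      show "compact (?P1 \<union> ?P3)" "closed (?P1 \<union> ?P2)"
        using arcs by (auto simp: arc_imp_path compact_path_image closed_path_image compact_Un)
      \<comment> \<open>Janiszewski's theorem asks that the two obstacles meet in a connected set;
        here this is the shared arc \<open>g1\<close>.\<close>
      have "(?P1 \<union> ?P3) \<inter> (?P1 \<union> ?P2) = ?P1"
        using int by blast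
      then show "connected ((?P1 \<union> ?P3) \<inter> (?P1 \<union> ?P2))"
        using arcs by (simp add: arc_imp_path connected_path_image)
      show "connected_component (- (?P1 \<union> ?P3)) p q"
        unfolding connected_component_def using 2 q' by (intro exI[of _ D2]) blast
      show "connected_component (- (?P1 \<union> ?P2)) p q"
        unfolding connected_component_def using 3 q' by (intro exI[of _ D3]) blast
    qed
    then obtain S where "connected S" "S \<inter> ?T = {}" "p \<in> S" "q \<in> S"
      unfolding connected_component_def by blast
    then have "S \<inter> frontier E1 \<noteq> {}"
      using connected_Int_frontier[of S E1] q False by blast
    then show ?thesis using 1 \<open>S \<inter> ?T = {}\<close> by blast
  qed
qed

section \<open>A subdivided $K_{3,3}$ in a planar graph\<close>

text \<open>The theta curve argument lives in the complex plane, so the drawing is carried over by a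
  linear isomorphism. Injectivity on vertices turns common end points into common vertices in the
  crossing condition.\<close>

lemma planar_graph_complexE:
  assumes "planar_graph V E"
  obtains p :: "'v \<Rightarrow> complex" and c :: "'v \<Rightarrow> 'v \<Rightarrow> real \<Rightarrow> complex"
  where "inj_on p V"
    and "\<And>u v. \<lbrakk>u \<in> V; v \<in> V; E u v\<rbrakk> \<Longrightarrow>
      arc (c u v) \<and> pathstart (c u v) = p u \<and> pathfinish (c u v) = p v"
    and "\<And>u v u' v'. \<lbrakk>u \<in> V; v \<in> V; E u v; u' \<in> V; v' \<in> V; E u' v'; {u, v} \<noteq> {u', v'}\<rbrakk> \<Longrightarrow>
      path_image (c u v) \<inter> path_image (c u' v') \<subseteq> p ` ({u, v} \<inter> {u', v'})"
proof -
  from assms obtain p :: "'v \<Rightarrow> real^2" and c :: "'v \<Rightarrow> 'v \<Rightarrow> real \<Rightarrow> real^2"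
    where inj: "inj_on p V"
      and edge: "\<And>u v. \<lbrakk>u \<in> V; v \<in> V; E u v\<rbrakk> \<Longrightarrow>
        arc (c u v) \<and> pathstart (c u v) = p u \<and> pathfinish (c u v) = p v"
      and cross: "\<And>u v u' v'. \<lbrakk>u \<in> V; v \<in> V; u' \<in> V; v' \<in> V; E u v; E u' v'; {u, v} \<noteq> {u', v'}\<rbrakk> \<Longrightarrow>
        path_image (c u v) \<inter> path_image (c u' v') \<subseteq> {p u, p v} \<inter> {p u', p v'}"
    unfolding planar_graph_def by metis
  define h :: "real^2 \<Rightarrow> complex" where "h = (\<lambda>x. Complex (x $ 1) (x $ 2))"
  have lin: "linear h"
    by (rule linearI) (auto simp: h_def complex_eq_iff)
  have inj_h: "inj h"
    by (auto simp: h_def inj_def vec_eq_iff forall_2)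
  show ?thesis
  proof (rule that[of "h \<circ> p" "\<lambda>u v. h \<circ> c u v"])
    show "inj_on (h \<circ> p) V"
      using inj inj_h by (meson comp_inj_on inj_on_subset subset_UNIV)
    show "arc (h \<circ> c u v) \<and> pathstart (h \<circ> c u v) = (h \<circ> p) u \<and> pathfinish (h \<circ> c u v) = (h \<circ> p) v"
      if "u \<in> V" "v \<in> V" "E u v" for u v
      using edge[OF that] arc_linear_image_eq[OF lin inj_h]
      by (simp add: pathstart_compose pathfinish_compose)
    show "path_image (h \<circ> c u v) \<inter> path_image (h \<circ> c u' v') \<subseteq> (h \<circ> p) ` ({u, v} \<inter> {u', v'})"
      if *: "u \<in> V" "v \<in> V" "E u v" "u' \<in> V" "v' \<in> V" "E u' v'" "{u, v} \<noteq> {u', v'}" for u v u' v'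
    proof -
      have "path_image (c u v) \<inter> path_image (c u' v') \<subseteq> p ` {u, v} \<inter> p ` {u', v'}"
        using cross[OF *(1,2,4,5,3,6,7)] by simp
      also have "\<dots> = p ` ({u, v} \<inter> {u', v'})"
        using * by (intro inj_on_image_Int[OF inj, symmetric]) auto
      finally have "h ` (path_image (c u v) \<inter> path_image (c u' v')) \<subseteq> h ` p ` ({u, v} \<inter> {u', v'})"
        by (rule image_mono)
      then show ?thesis
        by (simp only: path_image_compose image_Int[OF inj_h] image_comp)
    qed
  qed
qed

text \<open>A subdivided $K_{3,3}$: the theta graph formed by the paths $a, s_i, v_i, b$ (with
  $s_i = v_i$ allowed) together with a connected set of vertices off the theta graph that is
  adjacent to each $v_i$.\<close>

lemma not_planar_graphI:
  fixes a b x :: 'v and s v u :: "nat \<Rightarrow> 'v"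
  defines "T \<equiv> {a, b} \<union> s ` {..<3} \<union> v ` {..<3}"
  assumes V: "T \<subseteq> V" "x \<in> V - T"
    and ab: "a \<noteq> b"
    and sv: "\<And>i. i < 3 \<Longrightarrow> s i \<notin> {a, b} \<and> v i \<notin> {a, b}"
    and ne: "\<And>i j. \<lbrakk>i < 3; j < 3; i \<noteq> j\<rbrakk> \<Longrightarrow> {s i, v i} \<inter> {s j, v j} = {}"
    and edges: "\<And>i. i < 3 \<Longrightarrow> E a (s i) \<and> (s i = v i \<or> E (s i) (v i)) \<and> E (v i) b \<and> E (u i) (v i)"
    and reach: "\<And>i. i < 3 \<Longrightarrow> (\<lambda>y z. y \<in> V - T \<and> z \<in> V - T \<and> E y z)\<^sup>*\<^sup>* x (u i)"
  shows "\<not> planar_graph V E"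
proof
  assume "planar_graph V E"
  then obtain p :: "'v \<Rightarrow> complex" and c
    where inj: "inj_on p V"
      and arc: "\<And>u v. \<lbrakk>u \<in> V; v \<in> V; E u v\<rbrakk> \<Longrightarrow>
        arc (c u v) \<and> pathstart (c u v) = p u \<and> pathfinish (c u v) = p v"
      and cross: "\<And>u v u' v'. \<lbrakk>u \<in> V; v \<in> V; E u v; u' \<in> V; v' \<in> V; E u' v'; {u, v} \<noteq> {u', v'}\<rbrakk> \<Longrightarrow>
        path_image (c u v) \<inter> path_image (c u' v') \<subseteq> p ` ({u, v} \<inter> {u', v'})"
    by (rule planar_graph_complexE) (assumption | blast)+
  define F where "F i = (if s i = v i then {(a, v i), (v i, b)} else {(a, s i), (s i, v i), (v i, b)})" for i
  have FV: "y \<in> T" "z \<in> T" "E y z" if "(y, z) \<in> F i" "i < 3" for y z i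
    using that edges[of i] by (auto simp: F_def T_def split: if_splits)
  have g_ex: "\<exists>g. arc g \<and> pathstart g = p a \<and> pathfinish g = p b \<and>
      path_image g = (\<Union>(y, z)\<in>F i. path_image (c y z))" if i: "i < 3" for i
  proof -
    have VV: "a \<in> V" "b \<in> V" "s i \<in> V" "v i \<in> V"
      using V(1) i by (auto simp: T_def)
    note sv = sv[OF i] and edges = edges[OF i]
    have "\<exists>h. arc h \<and> pathstart h = p a \<and> pathfinish h = p (v i) \<and>
       path_image h = (\<Union>(y, z)\<in>F i - {(v i, b)}. path_image (c y z))"
    proof (cases "s i = v i")
      case True
      then have "F i - {(v i, b)} = {(a, v i)}"
        using sv by (auto simp: F_def)
      then show ?thesis
        using arc[of a "v i"] VV edges True by (intro exI[of _ "c a (v i)"]) simp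
    next
      case False
      then have F: "F i - {(v i, b)} = {(a, s i), (s i, v i)}"
        using sv by (auto simp: F_def)
      have "path_image (c a (s i)) \<inter> path_image (c (s i) (v i)) \<subseteq> {p (s i)}"
        using cross[of a "s i" "s i" "v i"] VV edges False sv by (auto simp: doubleton_eq_iff)
      then show ?thesis
        using arc[of a "s i"] arc[of "s i" "v i"] VV edges False
        by (intro exI[of _ "c a (s i) +++ c (s i) (v i)"]) (simp add: F arc_join path_image_join)
    qed
    then obtain h where h: "arc h" "pathstart h = p a" "pathfinish h = p (v i)"
       "path_image h = (\<Union>(y, z)\<in>F i - {(v i, b)}. path_image (c y z))" by blast
    have "path_image h \<inter> path_image (c (v i) b) \<subseteq> {p (v i)}"
      using cross[of a "v i" "v i" b] cross[of a "s i" "v i" b] cross[of "s i" "v i" "v i" b]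
        VV edges sv ab
      by (auto simp: h F_def doubleton_eq_iff split: if_splits)
    moreover have "F i = insert (v i, b) (F i - {(v i, b)})"
      by (auto simp: F_def)
    ultimately show ?thesis
      using h arc[of "v i" b] VV edges
      by (intro exI[of _ "h +++ c (v i) b"]) (auto simp: arc_join path_image_join)
  qed
  then obtain g where g: "\<And>i. i < 3 \<Longrightarrow> arc (g i) \<and> pathstart (g i) = p a \<and> pathfinish (g i) = p b"
    and im: "\<And>i. i < 3 \<Longrightarrow> path_image (g i) = (\<Union>(y, z)\<in>F i. path_image (c y z))"
    by metis
  have ends: "{p a, p b} \<subseteq> path_image (g i)" if "i < 3" for i
    using g[OF that] by (metis insert_subset empty_subsetI pathfinish_in_path_image pathstart_in_path_image)
  have int: "path_image (g i) \<inter> path_image (g j) = {p a, p b}" if ij: "i < 3" "j < 3" "i \<noteq> j" for i j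
  proof
    show "path_image (g i) \<inter> path_image (g j) \<subseteq> {p a, p b}"
    proof
      fix w assume "w \<in> path_image (g i) \<inter> path_image (g j)"
      then obtain y z y' z' where yz: "(y, z) \<in> F i" "(y', z') \<in> F j"
          "w \<in> path_image (c y z)" "w \<in> path_image (c y' z')"
        using ij by (auto simp: im)
      have "{y, z} \<inter> {y', z'} \<subseteq> {a, b}" "{y, z} \<noteq> {y', z'}"
        using yz(1,2) ne[OF ij] sv[OF ij(1)] sv[OF ij(2)] by (auto simp: F_def split: if_splits)
      then show "w \<in> {p a, p b}"
        using cross[of y z y' z'] FV[OF yz(1) ij(1)] FV[OF yz(2) ij(2)] V(1) yz(3,4) by blast
    qed
  qed (use ij ends in blast)
  let ?S = "- (path_image (g 0) \<union> path_image (g 1) \<union> path_image (g 2))"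
  have S: "w \<in> ?S \<longleftrightarrow> (\<forall>i<3. \<forall>(y, z)\<in>F i. w \<notin> path_image (c y z))" for w
    using im by (auto simp: numeral_3_eq_3 less_Suc_eq numeral_2_eq_2)
  define R where "R = connected_component_set ?S (p x)"
  \<comment> \<open>An edge with an end off \<open>T\<close> differs from every edge of the theta
    graph, so it can touch the graph only at an end lying in \<open>T\<close>.\<close>
  have edge_S: "path_image (c y z) - p ` ({y, z} \<inter> T) \<subseteq> ?S"
    if yz: "y \<in> V - T" "z \<in> V" "E y z" for y z
  proof
    fix w assume w: "w \<in> path_image (c y z) - p ` ({y, z} \<inter> T)"
    have "w \<notin> path_image (c y' z')" if F: "(y', z') \<in> F i" "i < 3" for i y' z'
    proof -
      note T = FV[OF F]
      have "{y, z} \<noteq> {y', z'}" "p ` ({y, z} \<inter> {y', z'}) \<subseteq> p ` ({y, z} \<inter> T)"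
        using T yz by (auto simp: doubleton_eq_iff)
      moreover have "y' \<in> V" "z' \<in> V" "y \<in> V" using T V(1) yz by blast+
      ultimately show ?thesis
        using cross[OF _ yz(2,3) _ _ T(3)] w by blast
    qed
    then show "w \<in> ?S" unfolding S by blast
  qed
  have pT: "p y \<in> ?S" if "y \<in> V - T" "z \<in> V" "E y z" for y z
  proof -
    have "p y \<in> path_image (c y z)"
      using arc[of y z] that by (metis DiffD1 pathstart_in_path_image)
    moreover have "p y \<notin> p ` ({y, z} \<inter> T)"
      using inj V(1) that by (auto simp: inj_on_def)
    ultimately show ?thesis using edge_S[OF that] by blast
  qed
  have in_R: "p y \<in> R" if "(\<lambda>y z. y \<in> V - T \<and> z \<in> V - T \<and> E y z)\<^sup>*\<^sup>* x y" "p x \<in> ?S" for y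
    using that(1)
  proof induction
    case base
    then show ?case using that(2) by (simp add: R_def)
  next
    case (step y z)
    have "path_image (c y z) \<subseteq> ?S" "arc (c y z)" "p y \<in> path_image (c y z)" "p z \<in> path_image (c y z)"
      using edge_S[of y z] step arc[of y z]
      by auto (metis pathstart_in_path_image pathfinish_in_path_image)+
    then have "connected_component ?S (p y) (p z)"
      unfolding connected_component_def by (metis arc_imp_path connected_path_image)
    then show ?case using step.IH unfolding R_def by (auto intro: connected_component_trans)
  qed
  have u: "u i \<in> V - T" if "i < 3" for i
    using reach[OF that] by (cases rule: rtranclp.cases) (use V in auto)
  \<comment> \<open>That \<open>p x\<close> is off the theta graph is read off an edge at
    \<open>x\<close>: the edge to \<open>v 0\<close> if the walk to \<open>u 0\<close> is trivial,
    otherwise the first edge of that walk.\<close>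
  have px: "p x \<in> ?S"
  proof (cases "x = u 0")
    case True
    moreover have "v 0 \<in> V" using V(1) by (auto simp: T_def)
    ultimately show ?thesis using pT[OF u[of 0]] edges[of 0] by simp
  next
    case False
    then obtain y where "y \<in> V - T" "E x y"
      using converse_rtranclpE[OF reach[of 0]] by (metis zero_less_numeral)
    then show ?thesis using pT[of x y] V(2) by blast
  qed
  have clo: "p (v i) \<in> closure R \<inter> (path_image (g i) - {p a, p b})" if i: "i < 3" for i
  proof -
    have vi: "v i \<in> T" "v i \<in> V" "u i \<in> V - T" "E (u i) (v i)" "a \<in> V" "b \<in> V" "E (v i) b"
      using i V u edges by (auto simp: T_def)
    define f where "f = c (u i) (v i)"
    have f: "arc f" "pathstart f = p (u i)" "pathfinish f = p (v i)"
      using arc[of "u i" "v i"] vi by (auto simp: f_def)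
    have cont: "continuous_on {0..1} f" using f(1) by (simp add: arc_def path_def)
    \<comment> \<open>Only the end at \<open>v i\<close> is dropped. The half-open edge is connected
      and contains \<open>p (u i)\<close>, so it lies in \<open>R\<close>, while its closure
      recovers \<open>p (v i)\<close>.\<close>
    have "f ` {0..<1} \<subseteq> path_image f - {p (v i)}"
    proof clarify
      fix t :: real assume t: "t \<in> {0..<1}"
      have "f t \<noteq> f 1"
        using t f(1) by (auto simp: arc_def dest: inj_onD[where x = t and y = 1])
      then show "f t \<in> path_image f - {p (v i)}"
        using t f(3) by (auto simp: path_image_def pathfinish_def)
    qed
    also have "\<dots> \<subseteq> ?S"
      using edge_S[of "u i" "v i"] vi by (auto simp: f_def)
    finally have "f ` {0..<1} \<subseteq> connected_component_set ?S (p (u i))"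
      using f(2) cont
      by (intro connected_component_maximal connected_continuous_image)
        (auto simp: pathstart_def intro: continuous_on_subset rev_image_eqI[of 0])
    also have "\<dots> = R"
      using in_R[OF reach[OF i] px] unfolding R_def by (rule connected_component_eq)
    finally have "closure (f ` {0..<1}) \<subseteq> closure R" by (rule closure_mono)
    moreover have "f ` closure {0..<1} \<subseteq> closure (f ` {0..<1})"
      using cont by (intro image_closure_subset) (auto intro: closure_subset[THEN subsetD])
    moreover have "f 1 = p (v i)" using f(3) by (simp add: pathfinish_def)
    moreover have "f 1 \<in> f ` closure {0..<1::real}" by simp
    ultimately have "p (v i) \<in> closure R" by auto
    moreover have "p (v i) \<in> path_image (c (v i) b)"
      using arc[of "v i" b] vi by (metis pathstart_in_path_image)
    then have "p (v i) \<in> path_image (g i)"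
      using im[OF i] by (auto simp: F_def)
    moreover have "p (v i) \<noteq> p a" "p (v i) \<noteq> p b"
      using inj vi sv[OF i] by (auto simp: inj_on_def)
    ultimately show ?thesis by blast
  qed
  have "\<exists>h\<in>{g 0, g 1, g 2}. closure R \<inter> (path_image h - {p a, p b}) = {}"
    using g int px by (intro theta_component_misses_arc) (auto simp: R_def)
  then show False using clo[of 0] clo[of 1] clo[of 2] by auto
qed

section \<open>Nonplanar subgroup graphs\<close>

context group
begin

text \<open>Two cosets suffice because \<open>t\<close> can be moved past \<open>H\<close> and
  \<open>t \<otimes> t\<close> falls back into \<open>H\<close>. Iterating this extension builds the
  finite connecting subgroups, with finiteness evident at each step.\<close>

lemma subgroup_extend:
  assumes H: "subgroup H G" and t: "t \<in> carrier G" "t \<otimes> t \<in> H"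
    and norm: "\<And>h. h \<in> H \<Longrightarrow> \<exists>h'\<in>H. t \<otimes> h = h' \<otimes> t"
  shows "subgroup (H \<union> (H #> t)) G"
proof (rule subgroupI)
  note HG = subgroup.mem_carrier[OF H] and mult = subgroup.m_closed[OF H]
    and inv = subgroup.m_inv_closed[OF H]
  have mem: "h \<otimes> t \<in> H #> t" if "h \<in> H" for h
    using that by (auto simp: r_coset_def)
  show "H \<union> (H #> t) \<subseteq> carrier G"
    using HG t by (auto simp: r_coset_def)
  show "H \<union> (H #> t) \<noteq> {}"
    using subgroup.one_closed[OF H] by blast
  show "inv x \<in> H \<union> (H #> t)" if x: "x \<in> H \<union> (H #> t)" for x
  proof (cases "x \<in> H")
    case False
    then obtain h where h: "h \<in> H" "x = h \<otimes> t" using x False by (auto simp: r_coset_def)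
    obtain h' where h': "h' \<in> H" "t \<otimes> inv h = h' \<otimes> t" using norm h inv by blast
    have "inv t = inv (t \<otimes> t) \<otimes> t"
      using t by (simp add: inv_mult_group m_assoc)
    then have "inv x = inv (t \<otimes> t) \<otimes> (t \<otimes> inv h)"
      using h t HG by (metis inv_closed inv_mult_group m_assoc m_closed)
    also have "\<dots> = (inv (t \<otimes> t) \<otimes> h') \<otimes> t"
      using h' t HG by (simp add: m_assoc)
    finally show ?thesis using mem h' t inv mult by auto
  qed (use inv in blast)
  show "x \<otimes> y \<in> H \<union> (H #> t)" if x: "x \<in> H \<union> (H #> t)" and y: "y \<in> H \<union> (H #> t)" for x y
  proof -
    have xc: "x \<in> carrier G" "y \<in> carrier G" using x y HG t by (auto simp: r_coset_def)
    show ?thesis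
    proof (cases "x \<in> H")
      case True
      show ?thesis
      proof (cases "y \<in> H")
        case False
        then obtain h where h: "h \<in> H" "y = h \<otimes> t" using y False by (auto simp: r_coset_def)
        then have "x \<otimes> y = (x \<otimes> h) \<otimes> t" using HG t xc by (simp add: m_assoc)
        then show ?thesis using mem mult True h by auto
      qed (use True mult in blast)
    next
      case False
      then obtain h where h: "h \<in> H" "x = h \<otimes> t" using x False by (auto simp: r_coset_def)
      show ?thesis
      proof (cases "y \<in> H")
        case True
        then obtain h' where h': "h' \<in> H" "t \<otimes> y = h' \<otimes> t" using norm by blast
        have "x \<otimes> y = h \<otimes> (t \<otimes> y)" using h xc HG t by (simp add: m_assoc)
        also have "\<dots> = (h \<otimes> h') \<otimes> t" using h h' HG t by (simp add: m_assoc)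
        finally show ?thesis using mem mult h h' by auto
      next
        case False
        then obtain k where k: "k \<in> H" "y = k \<otimes> t" using y False by (auto simp: r_coset_def)
        then obtain h' where h': "h' \<in> H" "t \<otimes> k = h' \<otimes> t" using norm by blast
        have "x \<otimes> y = h \<otimes> (t \<otimes> k) \<otimes> t" using h k HG t by (simp add: m_assoc)
        also have "\<dots> = (h \<otimes> h') \<otimes> (t \<otimes> t)" using h h' HG t by (simp add: m_assoc)
        finally show ?thesis using mult h h' t by auto
      qed
    qed
  qed
qed

text \<open>A subgroup strictly above \<open>H\<close> inside the two cosets contains some
  \<open>h \<otimes> t\<close>, hence \<open>t\<close>, hence both cosets.\<close>

lemma maximal_subgroup_extend:
  assumes H: "subgroup H G" and t: "t \<in> carrier G" "t \<otimes> t \<in> H" "t \<notin> H"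
    and norm: "\<And>h. h \<in> H \<Longrightarrow> \<exists>h'\<in>H. t \<otimes> h = h' \<otimes> t"
  shows "maximal_subgroup_of G H (H \<union> (H #> t))"
proof -
  have 1: "subgroup (H \<union> (H #> t)) G" by (rule subgroup_extend[OF H t(1,2) norm])
  have "t = \<one> \<otimes> t" using t by simp
  then have tm: "t \<in> H #> t" using subgroup.one_closed[OF H] by (auto simp: r_coset_def)
  have "\<not> (subgroup L G \<and> H \<subset> L \<and> L \<subset> H \<union> (H #> t))" for L
  proof
    assume "subgroup L G \<and> H \<subset> L \<and> L \<subset> H \<union> (H #> t)"
    then have L: "subgroup L G" "H \<subset> L" "L \<subset> H \<union> (H #> t)" by auto
    then obtain l where l: "l \<in> L" "l \<notin> H" by blast
    then obtain h where h: "h \<in> H" "l = h \<otimes> t" using L(3) by (auto simp: r_coset_def)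
    have "t = inv h \<otimes> l"
      using h t subgroup.mem_carrier[OF H] by (simp add: m_assoc[symmetric])
    then have "t \<in> L"
      using L h l by (metis psubsetD subgroup.m_closed subgroup.m_inv_closed)
    then have "H #> t \<subseteq> L" using L by (auto simp: r_coset_def intro: subgroup.m_closed)
    then show False using L by blast
  qed
  then show ?thesis
    unfolding maximal_subgroup_of_def using H 1 tm t(3) by blast
qed

lemma finite_extend: "finite H \<Longrightarrow> finite (H \<union> (H #> t))"
  by (simp add: r_coset_def)

lemma maximal_subgroup_over:
  assumes "subgroup H G" "subgroup J G" "finite J" "H \<subset> J"
  shows "\<exists>L. maximal_subgroup_of G H L \<and> L \<subseteq> J"
proof -
  let ?S = "{L. subgroup L G \<and> H \<subset> L \<and> L \<subseteq> J}"
  have "finite ?S" using assms(3) by (rule rev_finite_subset[OF finite_Pow_iff[THEN iffD2]]) auto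
  moreover have "J \<in> ?S" using assms by blast
  ultimately obtain L where L: "L \<in> ?S" "\<And>M. M \<in> ?S \<Longrightarrow> M \<subseteq> L \<Longrightarrow> M = L"
    using finite_has_minimal[of ?S] by (metis (no_types, lifting) empty_iff)
  have "\<not> (\<exists>M. subgroup M G \<and> H \<subset> M \<and> M \<subset> L)"
  proof
    assume "\<exists>M. subgroup M G \<and> H \<subset> M \<and> M \<subset> L"
    then obtain M where M: "subgroup M G" "H \<subset> M" "M \<subset> L" by blast
    then have "M \<in> ?S" using L(1) by blast
    then show False using L(2)[of M] M(3) by blast
  qed
  then show ?thesis unfolding maximal_subgroup_of_def using L(1) assms(1) by blast
qed

text \<open>Finiteness of \<open>J\<close> supplies the covering steps. The relation also records
  that each member contains \<open>H\<close>, which lets the chain avoid every vertex of a theta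
  graph that does not contain \<open>H\<close>.\<close>

lemma maximal_chain:
  assumes "subgroup H G" "subgroup J G" "finite J" "H \<subseteq> J"
  shows "(\<lambda>A B. subgroup A G \<and> subgroup B G \<and> H \<subseteq> A \<and> H \<subseteq> B \<and> maximal_subgroup_of G A B)\<^sup>*\<^sup>* H J"
  using assms(1,4)
proof (induction "card J - card H" arbitrary: H rule: less_induct)
  case less
  show ?case
  proof (cases "H = J")
    case False
    then obtain L where L: "maximal_subgroup_of G H L" "L \<subseteq> J"
      using maximal_subgroup_over[OF less.prems(1) assms(2,3)] less.prems by blast
    then have L': "subgroup L G" "H \<subset> L" by (auto simp: maximal_subgroup_of_def)
    have "card H < card L" "card L \<le> card J"
      using L L' assms(3) by (meson psubset_card_mono rev_finite_subset card_mono)+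
    then have "(\<lambda>A B. subgroup A G \<and> subgroup B G \<and> L \<subseteq> A \<and> L \<subseteq> B \<and> maximal_subgroup_of G A B)\<^sup>*\<^sup>* L J"
      using less.hyps[of L] L L' by simp
    then have "(\<lambda>A B. subgroup A G \<and> subgroup B G \<and> H \<subseteq> A \<and> H \<subseteq> B \<and> maximal_subgroup_of G A B)\<^sup>*\<^sup>* L J"
      by (rule mono_rtranclp[rule_format, rotated]) (use L' in blast)
    then show ?thesis
      by (rule converse_rtranclp_into_rtranclp[rotated]) (use L L' less.prems in blast)
  qed simp
qed

text \<open>The starting vertex of the cluster is \<open>K\<close>: a walk climbs from
  \<open>K\<close> to \<open>J i\<close> and descends to \<open>u i\<close>. Every subgroup on the
  way contains \<open>K\<close> or \<open>u i\<close>, so the two \<open>avoid\<close> conditions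
  keep it off \<open>T\<close>.\<close>

lemma not_planar_groupI:
  fixes A B K :: "'a set" and s v u J :: "nat \<Rightarrow> 'a set"
  defines "T \<equiv> {A, B} \<union> s ` {..<3} \<union> v ` {..<3}"
  assumes AB: "subgroup K G" "A \<noteq> B"
    and sv: "\<And>i. i < 3 \<Longrightarrow> s i \<notin> {A, B} \<and> v i \<notin> {A, B}"
    and ne: "\<And>i j. \<lbrakk>i < 3; j < 3; i \<noteq> j\<rbrakk> \<Longrightarrow> {s i, v i} \<inter> {s j, v j} = {}"
    and edges: "\<And>i. i < 3 \<Longrightarrow> subgroup_graph_adj G A (s i) \<and>
      (s i = v i \<or> subgroup_graph_adj G (s i) (v i)) \<and>
      subgroup_graph_adj G (v i) B \<and> maximal_subgroup_of G (v i) (u i)"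
    and J: "\<And>i. i < 3 \<Longrightarrow> subgroup (J i) G \<and> finite (J i) \<and> K \<subseteq> J i \<and> u i \<subseteq> J i"
    and avoid: "\<And>C. C \<in> T \<Longrightarrow> \<not> K \<subseteq> C" "\<And>C i. C \<in> T \<Longrightarrow> i < 3 \<Longrightarrow> \<not> u i \<subseteq> C"
  shows "\<not> planar_group G"
proof -
  let ?V = "{H. subgroup H G}"
  let ?R = "\<lambda>y z. y \<in> ?V - T \<and> z \<in> ?V - T \<and> subgroup_graph_adj G y z"
  have adj: "subgroup A G \<and> subgroup B G" if "subgroup_graph_adj G A B" for A B
    using that by (auto simp: subgroup_graph_adj_def maximal_subgroup_of_def)
  have sgT: "subgroup C G" if "C \<in> T" for C
  proof -
    have "subgroup A G" "subgroup B G" using adj edges[of 0] by auto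
    moreover have "subgroup (s i) G" "subgroup (v i) G" if "i < 3" for i
      using adj edges[OF that] by (auto simp: maximal_subgroup_of_def)
    ultimately show ?thesis using that unfolding T_def by auto
  qed
  have up: "?R\<^sup>*\<^sup>* H L \<and> ?R\<^sup>*\<^sup>* L H"
    if H: "subgroup H G" "subgroup L G" "finite L" "H \<subseteq> L" "\<And>C. C \<in> T \<Longrightarrow> \<not> H \<subseteq> C" for H L
  proof -
    have *: "?R\<^sup>*\<^sup>* H L"
      by (rule mono_rtranclp[rule_format, rotated, OF maximal_chain[OF H(1-4)]])
        (use H(5) in \<open>auto simp: subgroup_graph_adj_def\<close>)
    have "symp ?R" by (auto intro!: sympI simp: subgroup_graph_adj_def)
    then have "symp ?R\<^sup>*\<^sup>*" by (rule symp_rtranclp)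
    then show ?thesis using * by (auto dest: sympD)
  qed
  have "\<not> planar_graph ?V (subgroup_graph_adj G)"
  proof (rule not_planar_graphI[where a = A and b = B and x = K and s = s and v = v and u = u, folded T_def])
    show "T \<subseteq> ?V" using sgT by blast
    show "K \<in> ?V - T" using AB avoid(1) by auto
    show "?R\<^sup>*\<^sup>* K (u i)" if i: "i < 3" for i
    proof (rule rtranclp_trans)
      show "?R\<^sup>*\<^sup>* K (J i)" using up[of K "J i"] J[OF i] AB avoid(1) by blast
      have "subgroup (u i) G" using edges[OF i] by (auto simp: maximal_subgroup_of_def)
      then show "?R\<^sup>*\<^sup>* (J i) (u i)" using up[of "u i" "J i"] J[OF i] avoid(2)[OF _ i] by blast
    qed
  qed (use AB sv ne edges in \<open>auto simp: subgroup_graph_adj_def\<close>)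
  then show ?thesis by (simp add: planar_group_def)
qed

section \<open>Centralizers and extension by commuting elements\<close>

definition centralizer :: "'a \<Rightarrow> 'a set" where
  "centralizer y = {x \<in> carrier G. x \<otimes> y = y \<otimes> x}"

lemma subgroup_centralizer:
  assumes y: "y \<in> carrier G"
  shows "subgroup (centralizer y) G"
proof (rule subgroupI)
  show "inv a \<in> centralizer y" if "a \<in> centralizer y" for a
  proof -
    have a: "a \<in> carrier G" "a \<otimes> y = y \<otimes> a" using that by (auto simp: centralizer_def)
    have "inv a \<otimes> y = inv a \<otimes> (y \<otimes> a) \<otimes> inv a" using a(1) y by (simp add: m_assoc)
    also have "\<dots> = inv a \<otimes> (a \<otimes> y) \<otimes> inv a" by (simp only: a(2))
    also have "\<dots> = y \<otimes> inv a" using a(1) y by (simp add: m_assoc[symmetric])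
    finally show ?thesis using a by (simp add: centralizer_def)
  qed
  show "a \<otimes> b \<in> centralizer y" if "a \<in> centralizer y" "b \<in> centralizer y" for a b
    using that y by (auto simp: centralizer_def) (metis m_assoc)
qed (use y in \<open>auto simp: centralizer_def\<close>)

lemma centralizer_sym:
  assumes "x \<in> centralizer y" "y \<in> carrier G"
  shows "y \<in> centralizer x"
  using assms by (simp add: centralizer_def)

lemma
  assumes H: "subgroup H G" and t: "t \<in> carrier G" "t \<otimes> t \<in> H" and c: "H \<subseteq> centralizer t"
  shows subgroup_extend_comm: "subgroup (H \<union> (H #> t)) G"
    and maximal_subgroup_extend_comm: "t \<notin> H \<Longrightarrow> maximal_subgroup_of G H (H \<union> (H #> t))"
proof -
  have norm: "\<exists>h'\<in>H. t \<otimes> h = h' \<otimes> t" if "h \<in> H" for h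
    using that c by (force simp: centralizer_def)
  show "subgroup (H \<union> (H #> t)) G"
    by (rule subgroup_extend[OF H t norm])
  show "maximal_subgroup_of G H (H \<union> (H #> t))" if "t \<notin> H"
    by (rule maximal_subgroup_extend[OF H t that norm])
qed

lemma extend_subset_centralizer:
  assumes "H \<subseteq> centralizer w" "t \<in> centralizer w" "w \<in> carrier G"
  shows "H \<union> (H #> t) \<subseteq> centralizer w"
  using assms subgroup.m_closed[OF subgroup_centralizer] by (auto simp: r_coset_def)

lemma mem_extend:
  assumes "subgroup H G" "t \<in> carrier G"
  shows "t \<in> H \<union> (H #> t)"
  using assms subgroup.one_closed[of H G] by (force simp: r_coset_def)

section \<open>Nonplanarity from four-groups and from pairs of elements of order 4\<close>

lemma maximal_involution:
  assumes "z \<in> carrier G" "z \<noteq> \<one>" "z \<otimes> z = \<one>"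
  shows "maximal_subgroup_of G {\<one>} {\<one>, z}"
proof -
  have "maximal_subgroup_of G {\<one>} ({\<one>} \<union> ({\<one>} #> z))"
    using assms by (intro maximal_subgroup_extend_comm triv_subgroup) (auto simp: centralizer_def)
  moreover have "{\<one>} \<union> ({\<one>} #> z) = {\<one>, z}" using assms by (auto simp: r_coset_def)
  ultimately show ?thesis by simp
qed

lemma maximal_four_group:
  assumes z: "z \<in> carrier G" "z \<noteq> \<one>" "z \<otimes> z = \<one>"
    and t: "t \<in> carrier G" "t \<noteq> \<one>" "t \<otimes> t = \<one>"
    and zt: "z \<otimes> t = t \<otimes> z" "z \<noteq> t"
  shows "maximal_subgroup_of G {\<one>, z} {\<one>, z, t, z \<otimes> t}"
proof -
  have "subgroup {\<one>, z} G"
    using maximal_involution[OF z] by (simp add: maximal_subgroup_of_def)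
  then have "maximal_subgroup_of G {\<one>, z} ({\<one>, z} \<union> ({\<one>, z} #> t))"
    using assms by (intro maximal_subgroup_extend_comm) (auto simp: centralizer_def)
  moreover have "{\<one>, z} \<union> ({\<one>, z} #> t) = {\<one>, z, t, z \<otimes> t}"
    using assms by (auto simp: r_coset_def)
  ultimately show ?thesis by simp
qed

text \<open>The poles of the theta graph are \<open>{\<one>}\<close> and \<open>{\<one>, z}\<close>,
  and its paths run through \<open>{\<one>, t i}\<close> and the four-group of \<open>z\<close> and
  \<open>t i\<close>. Each four-group has a cover inside \<open>J i\<close>, and \<open>K\<close>
  ties these covers together into the third branch vertex.\<close>

lemma not_planar_three_four_groups:
  fixes t :: "nat \<Rightarrow> 'a" and J :: "nat \<Rightarrow> 'a set"
  assumes z: "z \<in> carrier G" "z \<noteq> \<one>" "z \<otimes> z = \<one>"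
    and t: "\<And>i. i < 3 \<Longrightarrow> t i \<in> carrier G \<and> t i \<otimes> t i = \<one> \<and> z \<otimes> t i = t i \<otimes> z \<and> t i \<notin> {\<one>, z}"
    and dist: "\<And>i j. \<lbrakk>i < 3; j < 3; i \<noteq> j\<rbrakk> \<Longrightarrow> t j \<notin> {t i, z \<otimes> t i}"
    and K: "subgroup K G" "z \<in> K" "K \<noteq> {\<one>, z}" "\<And>i. i < 3 \<Longrightarrow> K \<noteq> {\<one>, z, t i, z \<otimes> t i}"
    and J: "\<And>i. i < 3 \<Longrightarrow> subgroup (J i) G \<and> finite (J i) \<and> K \<subseteq> J i \<and> t i \<in> J i"
  shows "\<not> planar_group G"
proof -
  define V where "V i = {\<one>, z, t i, z \<otimes> t i}" for i
  have zt: "z \<otimes> t i \<noteq> \<one>" "z \<otimes> t i \<noteq> z" "z \<otimes> t i \<noteq> t i" if "i < 3" for i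
  proof -
    have t': "t i \<in> carrier G" "t i \<otimes> t i = \<one>" "t i \<noteq> \<one>" "t i \<noteq> z" using t[OF that] by auto
    then show "z \<otimes> t i \<noteq> \<one>" using z by (metis inv_equality)
    show "z \<otimes> t i \<noteq> z" "z \<otimes> t i \<noteq> t i" using t' z by simp_all
  qed
  have maxV: "maximal_subgroup_of G {\<one>, z} (V i)" "maximal_subgroup_of G {\<one>, t i} (V i)"
    if "i < 3" for i
    using maximal_four_group[of z "t i"] maximal_four_group[of "t i" z] t[OF that] z
    by (auto simp: V_def insert_commute simp del: r_cancel)
  have VJ: "V i \<subseteq> J i" if "i < 3" for i
    using J[OF that] K t[OF that] subgroup.one_closed subgroup.m_closed unfolding V_def by fast
  \<comment> \<open>As \<open>K\<close> contains \<open>z\<close>, inside \<open>V i\<close> it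
    could only be \<open>{\<one>, z}\<close> or \<open>V i\<close>, and both are excluded. So
    \<open>J i\<close> lies strictly above \<open>V i\<close> and leaves room for
    \<open>u i\<close>.\<close>
  have K_sub: "\<not> K \<subseteq> V i" if i: "i < 3" for i
  proof
    assume KV: "K \<subseteq> V i"
    have "\<one> \<in> K" using K(1) by (rule subgroup.one_closed)
    then obtain k where k: "k \<in> K" "k \<in> {t i, z \<otimes> t i}" using K KV by (auto simp: V_def)
    have "z \<otimes> (z \<otimes> t i) = t i" using z t[OF i] by (metis l_one m_assoc)
    then have "{t i, z \<otimes> t i} \<subseteq> K"
      using k K(1,2) subgroup.m_closed[OF K(1,2)] by auto metis
    then have "K = V i" using KV K(2) \<open>\<one> \<in> K\<close> by (auto simp: V_def)
    then show False using K(4)[OF i] by (simp add: V_def)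
  qed
  have "\<exists>u. maximal_subgroup_of G (V i) u \<and> u \<subseteq> J i" if i: "i < 3" for i
  proof (rule maximal_subgroup_over)
    show "subgroup (V i) G" using maxV[OF i] by (simp add: maximal_subgroup_of_def)
    show "V i \<subset> J i" using VJ[OF i] J[OF i] K_sub[OF i] by blast
  qed (use J i in auto)
  then obtain u where u: "\<And>i. i < 3 \<Longrightarrow> maximal_subgroup_of G (V i) (u i) \<and> u i \<subseteq> J i"
    by metis
  have uV: "V i \<subset> u i" if "i < 3" for i using u[OF that] by (simp add: maximal_subgroup_of_def)
  show ?thesis
  proof (rule not_planar_groupI[where A = "{\<one>}" and B = "{\<one>, z}" and s = "\<lambda>i. {\<one>, t i}"
        and v = V and u = u and K = K and J = J])
    let ?T = "{{\<one>}, {\<one>, z}} \<union> (\<lambda>i. {\<one>, t i}) ` {..<3} \<union> V ` {..<3}"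
    show "\<not> K \<subseteq> C" if C: "C \<in> ?T" for C
    proof
      assume "K \<subseteq> C"
      moreover from this have "C \<notin> V ` {..<3}" using K_sub by auto
      ultimately have "C = {\<one>, z}" using C K(2) z(2) t by auto
      moreover have "\<one> \<in> K" using K(1) by (rule subgroup.one_closed)
      ultimately show False using \<open>K \<subseteq> C\<close> K(2,3) by auto
    qed
    show "\<not> u i \<subseteq> C" if C: "C \<in> ?T" and i: "i < 3" for C i
    proof
      assume "u i \<subseteq> C"
      then have VC: "V i \<subset> C" using uV[OF i] by blast
      from C consider "C = {\<one>}" | "C = {\<one>, z}" | j where "j < 3" "C = {\<one>, t j}" | j where "j < 3" "C = V j"
        by auto
      then show False
      proof cases
        case 3
        then show ?thesis using VC z(2) t by (auto simp: V_def)
      next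
        case 4
        then have "i \<noteq> j" using VC by auto
        then show ?thesis using VC 4 dist[of j i] t[OF i] i by (auto simp: V_def)
      qed (use VC t[OF i] z(2) in \<open>auto simp: V_def\<close>)
    qed
    show "{\<one>, t i} \<notin> {{\<one>}, {\<one>, z}} \<and> V i \<notin> {{\<one>}, {\<one>, z}}" if "i < 3" for i
      using t[OF that] by (auto simp: V_def doubleton_eq_iff)
    show "{{\<one>, t i}, V i} \<inter> {{\<one>, t j}, V j} = {}" if ij: "i < 3" "j < 3" "i \<noteq> j" for i j
    proof -
      have "{\<one>, t i} \<noteq> {\<one>, t j}" using dist[OF ij] by (auto simp: doubleton_eq_iff)
      moreover have "z \<in> V i" "z \<in> V j" "z \<notin> {\<one>, t i}" "z \<notin> {\<one>, t j}"
        using z(2) t[OF ij(1)] t[OF ij(2)] by (simp_all add: V_def eq_commute[of z])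
      then have "{\<one>, t i} \<noteq> V j" "V i \<noteq> {\<one>, t j}"
        by blast+
      moreover have "t j \<in> V j" "t j \<notin> V i"
        using dist[OF ij] t[OF ij(2)] by (simp_all add: V_def)
      then have "V i \<noteq> V j" by blast
      ultimately show ?thesis by auto
    qed
    show "subgroup_graph_adj G {\<one>} {\<one>, t i} \<and> ({\<one>, t i} = V i \<or> subgroup_graph_adj G {\<one>, t i} (V i)) \<and>
      subgroup_graph_adj G (V i) {\<one>, z} \<and> maximal_subgroup_of G (V i) (u i)" if i: "i < 3" for i
      using maxV[OF i] u[OF i] maximal_involution[of "t i"] t[OF i]
      by (auto simp: subgroup_graph_adj_def)
    show "subgroup (J i) G \<and> finite (J i) \<and> K \<subseteq> J i \<and> u i \<subseteq> J i" if "i < 3" for i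
      using J[OF that] u[OF that] by blast
  qed (use K z in auto)
qed

lemma comm_square:
  assumes "x \<in> carrier G" "y \<in> carrier G" "x \<otimes> y = y \<otimes> x"
  shows "(x \<otimes> y) \<otimes> (x \<otimes> y) = (x \<otimes> x) \<otimes> (y \<otimes> y)"
  using assms by (metis m_assoc m_closed)

text \<open>The poles are \<open>{\<one>}\<close> and the four-group of \<open>p\<close> and
  \<open>q\<close>, and the paths are its three subgroups of order 2. Each of these is also covered
  by a cyclic group of order 4, generated by \<open>x\<close>, \<open>y\<close> or
  \<open>x \<otimes> y\<close>. The cyclic groups are linked through the finite group generated by
  \<open>x\<close> and \<open>y\<close>.\<close>

lemma not_planar_order_four_pair:
  assumes xy: "x \<in> carrier G" "y \<in> carrier G" "x \<otimes> y = y \<otimes> x"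
    and p: "p = x \<otimes> x" "p \<otimes> p = \<one>" "p \<noteq> \<one>"
    and q: "q = y \<otimes> y" "q \<otimes> q = \<one>" "q \<noteq> \<one>" and pq: "p \<noteq> q"
  shows "\<not> planar_group G"
proof -
  have cl: "p \<in> carrier G" "q \<in> carrier G" using xy p q by auto
  have cc: "x \<in> centralizer x" "x \<in> centralizer y" "y \<in> centralizer x" "y \<in> centralizer y"
    using xy by (auto simp: centralizer_def)
  have cp: "p \<in> centralizer x" "p \<in> centralizer y" "q \<in> centralizer x" "q \<in> centralizer y"
    using cc subgroup.m_closed[OF subgroup_centralizer] xy p q by auto
  have cq: "x \<in> centralizer q" "p \<in> centralizer q"
    using cp cl xy centralizer_sym p subgroup.m_closed[OF subgroup_centralizer[of q]] by blast+
  have pq': "p \<otimes> q = q \<otimes> p" using cq by (simp add: centralizer_def)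
  define e where "e i = (if i = 0 then p else if i = 1 then q else p \<otimes> q)" for i :: nat
  define r where "r i = (if i = 0 then x else if i = 1 then y else x \<otimes> y)" for i :: nat
  have e: "e i \<in> carrier G" "e i \<otimes> e i = \<one>" "e i \<noteq> \<one>" "r i \<otimes> r i = e i" "r i \<in> carrier G" for i
  proof -
    have "p \<otimes> q \<noteq> \<one>" using p q pq cl by (metis inv_equality)
    then show "e i \<in> carrier G" "e i \<otimes> e i = \<one>" "e i \<noteq> \<one>" "r i \<otimes> r i = e i" "r i \<in> carrier G"
      using p q cl pq' comm_square[OF cl pq'] comm_square[OF xy] xy by (auto simp: e_def r_def)
  qed
  have e_dist: "e i \<noteq> e j" if "i < 3" "j < 3" "i \<noteq> j" for i j
  proof -
    have "p \<noteq> p \<otimes> q" "q \<noteq> p \<otimes> q" using p q cl by (metis l_cancel_one' r_cancel_one')+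
    then show ?thesis using that pq by (auto simp: e_def)
  qed
  have re: "e i \<in> centralizer (r i)" for i
    using e(1)[of i] e(5)[of i] by (simp add: centralizer_def e(4)[symmetric] m_assoc)
  define A where "A i = {\<one>, e i}" for i
  define V where "V = {\<one>, p, q, p \<otimes> q}"
  have maxA: "maximal_subgroup_of G {\<one>} (A i)" for i
    unfolding A_def using e by (intro maximal_involution)
  have maxV: "maximal_subgroup_of G (A i) V" for i
  proof -
    have "p \<otimes> (p \<otimes> q) = q" using p(2) cl by (simp add: m_assoc[symmetric])
    moreover from this have "(p \<otimes> q) \<otimes> p = q" using pq' cl by (metis m_assoc)
    moreover have "p \<otimes> q \<noteq> \<one>" "p \<otimes> q \<noteq> p" using p q pq cl by (metis inv_equality, simp)
    moreover have "(p \<otimes> q) \<otimes> (p \<otimes> q) = \<one>" using e(2)[of 2] by (simp add: e_def)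
    ultimately show ?thesis
      using maximal_four_group[of p q] maximal_four_group[of q p] maximal_four_group[of "p \<otimes> q" p]
        p q pq pq' cl by (auto simp: A_def V_def e_def insert_commute)
  qed
  have sgA: "subgroup (A i) G" for i using maxA by (simp add: maximal_subgroup_of_def)
  define C where "C i = A i \<union> (A i #> r i)" for i
  have sq: "g \<otimes> g = \<one>" if "g \<in> V" for g
    using that p q e(2)[of 2] cl by (auto simp: V_def e_def)
  have AV: "A i \<subseteq> V" for i using maxV by (auto simp: maximal_subgroup_of_def)
  have rV: "r i \<notin> V" for i using sq[of "r i"] e by metis
  have maxC: "maximal_subgroup_of G (A i) (C i)" for i
    unfolding C_def
  proof (rule maximal_subgroup_extend_comm[OF sgA])
    show "r i \<notin> A i" using AV rV by blast
  qed (use e re in \<open>auto simp: A_def centralizer_def\<close>)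
  have rC: "r i \<in> C i" for i unfolding C_def by (rule mem_extend[OF sgA e(5)])
  \<comment> \<open>Each extension asks that the square of the new element be present already, so
    \<open>q\<close> is adjoined before its root \<open>y\<close>.\<close>
  define K1 where "K1 = C 0 \<union> (C 0 #> q)"
  define K2 where "K2 = K1 \<union> (K1 #> y)"
  have C0: "subgroup (C 0) G" using maxC by (simp add: maximal_subgroup_of_def)
  have A0: "A 0 \<subseteq> centralizer q" "A 0 \<subseteq> centralizer y"
    using cq cp xy cl by (auto simp: A_def e_def centralizer_def)
  have C0c: "C 0 \<subseteq> centralizer q" "C 0 \<subseteq> centralizer y"
    unfolding C_def using A0 cq cc xy cl by (intro extend_subset_centralizer; simp add: r_def)+
  have K1: "subgroup K1 G"
    unfolding K1_def using C0 cl q C0c subgroup.one_closed[OF C0] by (intro subgroup_extend_comm) auto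
  have "q \<in> K1" unfolding K1_def by (rule mem_extend[OF C0 cl(2)])
  moreover have "K1 \<subseteq> centralizer y"
    unfolding K1_def using C0c cp xy by (intro extend_subset_centralizer)
  ultimately have K2: "subgroup K2 G"
    unfolding K2_def using K1 q xy by (intro subgroup_extend_comm) auto
  have "finite K2" unfolding K2_def K1_def C_def by (intro finite_extend) (simp add: A_def)
  have mem: "x \<in> K2" "y \<in> K2"
    using rC[of 0] mem_extend[OF K1 xy(2)] by (auto simp: K2_def K1_def r_def)
  have rK: "r i \<in> K2" for i using mem subgroup.m_closed[OF K2] by (auto simp: r_def)
  have CK: "C i \<subseteq> K2" for i
  proof -
    have "e i \<in> K2" using rK subgroup.m_closed[OF K2] e(4) by metis
    then show ?thesis
      using rK subgroup.m_closed[OF K2] subgroup.one_closed[OF K2] by (auto simp: C_def A_def r_coset_def)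
  qed
  show ?thesis
  proof (rule not_planar_groupI[where A = "{\<one>}" and B = V and s = A and v = A and u = C
        and K = K2 and J = "\<lambda>_. K2"])
    let ?T = "{{\<one>}, V} \<union> A ` {..<3} \<union> A ` {..<3}"
    have T: "D \<subseteq> V" if "D \<in> ?T" for D
      using that AV by (auto simp: V_def)
    show "\<not> K2 \<subseteq> D" if "D \<in> ?T" for D
      using T[OF that] rK[of 0] rV[of 0] by blast
    show "\<not> C i \<subseteq> D" if "D \<in> ?T" for D i
      using T[OF that] rC[of i] rV[of i] by blast
    show "{\<one>} \<noteq> V" using p by (auto simp: V_def)
    show "A i \<notin> {{\<one>}, V} \<and> A i \<notin> {{\<one>}, V}" for i
      using maxA[of i] maxV[of i] by (auto simp: maximal_subgroup_of_def)
    show "{A i, A i} \<inter> {A j, A j} = {}" if "i < 3" "j < 3" "i \<noteq> j" for i j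
      using e_dist[OF that] by (auto simp: A_def doubleton_eq_iff)
  qed (use K2 \<open>finite K2\<close> CK maxA maxV maxC in \<open>auto simp: subgroup_graph_adj_def\<close>)
qed

end

section \<open>Finiteness of square roots\<close>

lemma planar_graph_embedding:
  assumes "planar_graph V E" and inj: "inj_on f V'" and "f ` V' \<subseteq> V"
    and "\<And>u v. \<lbrakk>u \<in> V'; v \<in> V'; E' u v\<rbrakk> \<Longrightarrow> E (f u) (f v)"
  shows "planar_graph V' E'"
proof -
  from assms(1) obtain p :: "'a \<Rightarrow> real^2" and c
    where p: "inj_on p V"
      and c: "\<And>u v. \<lbrakk>u \<in> V; v \<in> V; E u v\<rbrakk> \<Longrightarrow> arc (c u v) \<and> pathstart (c u v) = p u \<and>
        pathfinish (c u v) = p v \<and> path_image (c u v) \<inter> p ` V = {p u, p v} \<and> c v u = reversepath (c u v)"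
      and cross: "\<And>u v u' v'. \<lbrakk>u \<in> V; v \<in> V; u' \<in> V; v' \<in> V; E u v; E u' v'; {u, v} \<noteq> {u', v'}\<rbrakk> \<Longrightarrow>
        path_image (c u v) \<inter> path_image (c u' v') \<subseteq> {p u, p v} \<inter> {p u', p v'}"
    unfolding planar_graph_def by metis
  have fV: "f v \<in> V" if "v \<in> V'" for v using that assms(3) by blast
  show ?thesis
    unfolding planar_graph_def
  proof (intro exI[of _ "p \<circ> f"] exI[of _ "\<lambda>u v. c (f u) (f v)"] conjI ballI impI)
    show "inj_on (p \<circ> f) V'"
      using inj p assms(3) by (meson comp_inj_on inj_on_subset)
  next
    fix u v assume uv: "u \<in> V'" "v \<in> V'" "E' u v"
    note C = c[OF fV[OF uv(1)] fV[OF uv(2)] assms(4)[OF uv]]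
    show "arc (c (f u) (f v))" "pathstart (c (f u) (f v)) = (p \<circ> f) u"
      "pathfinish (c (f u) (f v)) = (p \<circ> f) v" "c (f v) (f u) = reversepath (c (f u) (f v))"
      using C by auto
    have "(p \<circ> f) ` V' \<subseteq> p ` V" "{(p \<circ> f) u, (p \<circ> f) v} \<subseteq> (p \<circ> f) ` V'"
      using fV uv by auto
    then show "path_image (c (f u) (f v)) \<inter> (p \<circ> f) ` V' = {(p \<circ> f) u, (p \<circ> f) v}"
      using C by auto
  next
    fix u v u' v' assume *: "u \<in> V'" "v \<in> V'" "u' \<in> V'" "v' \<in> V'"
      "E' u v \<and> E' u' v' \<and> {u, v} \<noteq> {u', v'}"
    have "{f u, f v} \<noteq> {f u', f v'}"
      using * inj by (auto simp: doubleton_eq_iff inj_on_eq_iff)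
    then show "path_image (c (f u) (f v)) \<inter> path_image (c (f u') (f v'))
      \<subseteq> {(p \<circ> f) u, (p \<circ> f) v} \<inter> {(p \<circ> f) u', (p \<circ> f) v'}"
      using * cross[of "f u" "f v" "f u'" "f v'"] fV assms(4) by simp
  qed
qed

lemma two_groupD:
  assumes "group G" "two_group G" "x \<in> carrier G"
  shows "\<exists>n::nat. x [^]\<^bsub>G\<^esub> (2 ^ n :: nat) = \<one>\<^bsub>G\<^esub>"
  using assms group.pow_ord_eq_1[of G x] by (metis two_group_def)

lemma two_groupI:
  assumes "group G" "\<And>x. x \<in> carrier G \<Longrightarrow> \<exists>n::nat. x [^]\<^bsub>G\<^esub> (2 ^ n :: nat) = \<one>\<^bsub>G\<^esub>"
  shows "two_group G"
  unfolding two_group_def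
proof
  fix x assume x: "x \<in> carrier G"
  then obtain n :: nat where "x [^]\<^bsub>G\<^esub> (2 ^ n :: nat) = \<one>\<^bsub>G\<^esub>" using assms(2) by blast
  then have "group.ord G x dvd 2 ^ n"
    using group.pow_eq_id[OF assms(1) x] by simp
  then show "\<exists>n. group.ord G x = 2 ^ n"
    using divides_primepow_nat[OF two_is_prime_nat] by blast
qed

context group
begin

lemma two_group_subgroup:
  assumes "subgroup H G" "two_group G"
  shows "two_group (G\<lparr>carrier := H\<rparr>)"
proof (rule two_groupI)
  show "group (G\<lparr>carrier := H\<rparr>)" by (rule subgroup_imp_group[OF assms(1)])
  show "\<exists>n::nat. x [^]\<^bsub>G\<lparr>carrier := H\<rparr>\<^esub> (2 ^ n :: nat) = \<one>\<^bsub>G\<lparr>carrier := H\<rparr>\<^esub>"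
    if "x \<in> carrier (G\<lparr>carrier := H\<rparr>)" for x
    using two_groupD[OF is_group assms(2)] subgroup.mem_carrier[OF assms(1)] that
    by (simp flip: nat_pow_consistent)
qed

lemma planar_group_subgroup:
  assumes H: "subgroup H G" and "planar_group G"
  shows "planar_group (G\<lparr>carrier := H\<rparr>)"
  unfolding planar_group_def
proof (rule planar_graph_embedding[OF assms(2)[unfolded planar_group_def], where f = id])
  let ?H = "G\<lparr>carrier := H\<rparr>"
  have iff: "subgroup K ?H \<longleftrightarrow> subgroup K G \<and> K \<subseteq> H" for K
    using incl_subgroup[OF H] subgroup_incl[OF _ H] subgroup.subset[of K ?H] by auto
  have "maximal_subgroup_of G A B" if "maximal_subgroup_of ?H A B" for A B
  proof -
    have B: "subgroup A G" "subgroup B G" "A \<subset> B" "B \<subseteq> H"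
      and no: "\<not> (subgroup L ?H \<and> A \<subset> L \<and> L \<subset> B)" for L
      using that by (auto simp: maximal_subgroup_of_def iff)
    have "\<not> (subgroup L G \<and> A \<subset> L \<and> L \<subset> B)" for L
      using no[of L] B(4) iff[of L] by (meson psubset_imp_subset subset_trans)
    then show ?thesis using B by (auto simp: maximal_subgroup_of_def)
  qed
  then show "subgroup_graph_adj G (id A) (id B)" if "subgroup_graph_adj ?H A B" for A B
    using that by (auto simp: subgroup_graph_adj_def)
  show "id ` {K. subgroup K ?H} \<subseteq> {K. subgroup K G}" using iff by auto
qed auto

end

context normal
begin

lemma two_group_FactGroup:
  assumes "two_group G"
  shows "two_group (G Mod H)"
proof (rule two_groupI)
  show "group (G Mod H)" by (rule factorgroup_is_group)
  fix Y assume "Y \<in> carrier (G Mod H)"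
  then obtain x where x: "x \<in> carrier G" "Y = H #> x"
    by (auto simp: FactGroup_def RCOSETS_def)
  obtain n :: nat where n: "x [^] (2 ^ n :: nat) = \<one>"
    using two_groupD[OF is_group assms x(1)] by blast
  interpret h: group_hom G "G Mod H" "\<lambda>a. H #> a"
    using r_coset_hom_Mod factorgroup_is_group is_group
    by (simp add: group_hom_def group_hom_axioms_def)
  have "Y [^]\<^bsub>G Mod H\<^esub> (2 ^ n :: nat) = \<one>\<^bsub>G Mod H\<^esub>"
    using h.hom_nat_pow[OF x(1), of "2 ^ n"] x n h.hom_one by simp
  then show "\<exists>n::nat. Y [^]\<^bsub>G Mod H\<^esub> (2 ^ n :: nat) = \<one>\<^bsub>G Mod H\<^esub>" by blast
qed

text \<open>By the correspondence theorem the subgroup graph of the quotient is the part of the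
  graph of \<open>G\<close> above \<open>H\<close>. \<open>Union\<close> sends a set of cosets to
  its preimage in \<open>G\<close>, and \<open>img\<close> recovers the set of cosets.\<close>

lemma planar_group_FactGroup:
  assumes "planar_group G"
  shows "planar_group (G Mod H)"
  unfolding planar_group_def
proof (rule planar_graph_embedding[OF assms(1)[unfolded planar_group_def], where f = Union])
  interpret h: group_hom G "G Mod H" "\<lambda>a. H #> a"
    using r_coset_hom_Mod factorgroup_is_group is_group
    by (simp add: group_hom_def group_hom_axioms_def)
  have img: "(\<lambda>x. H #> x) ` \<Union>A = A" if A: "subgroup A (G Mod H)" for A
  proof
    show "(\<lambda>x. H #> x) ` \<Union>A \<subseteq> A"
      using factgroup_subgroup_union_char[OF A] by auto
    show "A \<subseteq> (\<lambda>x. H #> x) ` \<Union>A"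
    proof
      fix Y assume Y: "Y \<in> A"
      then have "Y \<in> carrier (G Mod H)" using subgroup.mem_carrier[OF A] by blast
      then obtain x where "x \<in> carrier G" "Y = H #> x" by (auto simp: FactGroup_def RCOSETS_def)
      then show "Y \<in> (\<lambda>x. H #> x) ` \<Union>A"
        using Y unfolding factgroup_subgroup_union_char[OF A] by blast
    qed
  qed
  show "inj_on Union {K. subgroup K (G Mod H)}"
    by (rule inj_on_inverseI[of _ "\<lambda>K. (\<lambda>x. H #> x) ` K"]) (use img in auto)
  show "Union ` {K. subgroup K (G Mod H)} \<subseteq> {K. subgroup K G}"
    using factgroup_subgroup_union_subgroup by auto
  have "maximal_subgroup_of G (\<Union>A) (\<Union>B)" if max: "maximal_subgroup_of (G Mod H) A B" for A B
  proof -
    have A: "subgroup A (G Mod H)" "subgroup B (G Mod H)" "A \<subset> B"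
      using max by (auto simp: maximal_subgroup_of_def)
    have no: "\<not> (subgroup L G \<and> \<Union>A \<subset> L \<and> L \<subset> \<Union>B)" for L
    proof
      assume "subgroup L G \<and> \<Union>A \<subset> L \<and> L \<subset> \<Union>B"
      then have L: "subgroup L G" "\<Union>A \<subset> L" "L \<subset> \<Union>B" by auto
      let ?L = "(\<lambda>x. H #> x) ` L"
      \<comment> \<open>The coset \<open>H\<close> is the identity of the quotient, hence a member
        of \<open>A\<close>; so \<open>L\<close> is a union of cosets of \<open>H\<close>.\<close>
      have HL: "H \<subseteq> L"
        using subgroup.one_closed[OF A(1)] L(2) by auto
      have mem: "x \<in> L" if x: "x \<in> carrier G" "H #> x \<in> ?L" for x
      proof -
        obtain l where l: "l \<in> L" "H #> x = H #> l" using x by blast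
        then have "x \<in> H #> l" using rcos_self[OF x(1) is_subgroup] by simp
        then show ?thesis
          using HL l(1) subgroup.m_closed[OF L(1)] by (auto simp: r_coset_def)
      qed
      have "A \<subseteq> ?L"
        using image_mono[of "\<Union>A" L "\<lambda>x. H #> x"] L(2) unfolding img[OF A(1)] by simp
      moreover have "?L \<subseteq> B"
        using image_mono[of L "\<Union>B" "\<lambda>x. H #> x"] L(3) unfolding img[OF A(2)] by simp
      moreover have "A \<noteq> ?L"
      proof
        assume AL: "A = ?L"
        obtain x where x: "x \<in> L" "x \<notin> \<Union>A" using L(2) by (elim psubsetE) (meson subsetI)
        have "H #> x \<in> A" unfolding AL using x(1) by (rule imageI)
        then show False
          using x subgroup.mem_carrier[OF L(1)] unfolding factgroup_subgroup_union_char[OF A(1)] by simp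
      qed
      moreover have "?L \<noteq> B"
      proof
        assume BL: "?L = B"
        obtain x where x: "x \<in> \<Union>B" "x \<notin> L" using L(3) by (elim psubsetE) (meson subsetI)
        then have "x \<in> carrier G" "H #> x \<in> B"
          unfolding factgroup_subgroup_union_char[OF A(2)] by simp_all
        then show False using mem x(2) unfolding BL[symmetric] by simp
      qed
      moreover have "subgroup ?L (G Mod H)" by (rule h.subgroup_img_is_subgroup[OF L(1)])
      ultimately show False using max unfolding maximal_subgroup_of_def by (meson psubsetI)
    qed
    have "\<Union>A \<noteq> \<Union>B"
      using img[OF A(1)] img[OF A(2)] A(3) by (metis psubset_eq)
    moreover have "\<Union>A \<subseteq> \<Union>B" using A(3) by (intro Union_mono psubset_imp_subset)
    ultimately show ?thesis
      using no factgroup_subgroup_union_subgroup[OF A(1)] factgroup_subgroup_union_subgroup[OF A(2)]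
      unfolding maximal_subgroup_of_def by (simp add: psubsetI)
  qed
  then show "subgroup_graph_adj G (\<Union>A) (\<Union>B)" if "subgroup_graph_adj (G Mod H) A B" for A B
    using that by (auto simp: subgroup_graph_adj_def)
qed

end

section \<open>Dihedral subgroups and the counting of involutions and roots\<close>

context group
begin

lemma finite_powers:
  assumes "a \<in> carrier G" "a [^] (n::nat) = \<one>" "0 < n"
  shows "subgroup (range (\<lambda>k::nat. a [^] k)) G" "finite (range (\<lambda>k::nat. a [^] k))"
proof -
  have "ord a \<noteq> 0" using assms pow_eq_id by auto
  then have "generate G {a} = range (\<lambda>k::nat. a [^] k)"
    using generate_pow_nat[OF assms(1)] by (simp add: full_SetCompr_eq)
  moreover have "finite (generate G {a})"
    using generate_pow_card[OF assms(1)] \<open>ord a \<noteq> 0\<close> by (intro card_ge_0_finite) simp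
  ultimately show "subgroup (range (\<lambda>k::nat. a [^] k)) G" "finite (range (\<lambda>k::nat. a [^] k))"
    using generate_is_subgroup[of "{a}"] assms(1) by auto
qed

text \<open>The dihedral relations: the inverse of \<open>s \<otimes> t\<close> is
  \<open>t \<otimes> s\<close>, so both reflections invert the rotation and all its powers.\<close>

lemma involutions_invert:
  assumes s: "s \<in> carrier G" "s \<otimes> s = \<one>" and t: "t \<in> carrier G" "t \<otimes> t = \<one>"
  shows "s \<otimes> (s \<otimes> t) [^] (k::nat) = inv ((s \<otimes> t) [^] k) \<otimes> s"
    and "t \<otimes> (s \<otimes> t) [^] (k::nat) = inv ((s \<otimes> t) [^] k) \<otimes> t"
proof -
  have inv: "inv (s \<otimes> t) = t \<otimes> s" using s t by (simp add: inv_mult_group inv_equality)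
  have pow: "g \<otimes> a [^] k = inv (a [^] k) \<otimes> g"
    if "g \<in> carrier G" "a \<in> carrier G" "g \<otimes> a = inv a \<otimes> g" for g a and k :: nat
  proof (induction k)
    case (Suc k)
    have "g \<otimes> a [^] Suc k = (g \<otimes> a [^] k) \<otimes> a" using that by (simp add: m_assoc)
    also have "\<dots> = inv (a [^] k) \<otimes> (g \<otimes> a)" using that Suc by (simp add: m_assoc)
    also have "\<dots> = (inv (a [^] k) \<otimes> inv a) \<otimes> g" using that by (simp add: m_assoc)
    also have "inv (a [^] k) \<otimes> inv a = inv (a [^] Suc k)"
      using that by (metis inv_mult_group nat_pow_Suc2 nat_pow_closed)
    finally show ?case .
  qed (use that in simp)
  have "s \<otimes> (s \<otimes> t) = inv (s \<otimes> t) \<otimes> s" "t \<otimes> (s \<otimes> t) = inv (s \<otimes> t) \<otimes> t"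
    using s t by (simp_all add: inv m_assoc) (simp add: m_assoc[symmetric])
  then show "s \<otimes> (s \<otimes> t) [^] k = inv ((s \<otimes> t) [^] k) \<otimes> s"
    "t \<otimes> (s \<otimes> t) [^] k = inv ((s \<otimes> t) [^] k) \<otimes> t"
    using pow s t by simp_all
qed

text \<open>The rotations form a finite cyclic group; adjoining the commuting \<open>z\<close> and
  then the reflection \<open>s\<close> keeps it finite. The other reflection is \<open>s\<close>
  times the rotation \<open>s \<otimes> t\<close>.\<close>

lemma finite_subgroup_two_involutions:
  assumes s: "s \<in> carrier G" "s \<otimes> s = \<one>" and t: "t \<in> carrier G" "t \<otimes> t = \<one>"
    and z: "z \<in> carrier G" "z \<otimes> z = \<one>" "z \<otimes> s = s \<otimes> z" "z \<otimes> t = t \<otimes> z"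
    and n: "(s \<otimes> t) [^] (n::nat) = \<one>" "0 < n"
  shows "\<exists>J. subgroup J G \<and> finite J \<and> {s, t, z} \<subseteq> J"
proof -
  define a where "a = s \<otimes> t"
  have a: "a \<in> carrier G" using s t by (simp add: a_def)
  define H where "H = range (\<lambda>k::nat. a [^] k)"
  have H: "subgroup H G" "finite H" using finite_powers a n by (auto simp: a_def H_def)
  have one: "\<one> \<in> H" using H(1) by (rule subgroup.one_closed)
  have "s \<in> centralizer z" "t \<in> centralizer z" using s t z by (auto simp: centralizer_def)
  then have ac: "a \<in> centralizer z"
    using subgroup.m_closed[OF subgroup_centralizer] z by (auto simp: a_def)
  have Hc: "H \<subseteq> centralizer z"
  proof -
    have "a [^] k \<in> centralizer z" for k :: nat
      using ac a subgroup.m_closed[OF subgroup_centralizer[OF z(1)]]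
        subgroup.one_closed[OF subgroup_centralizer[OF z(1)]] by (induction k) auto
    then show ?thesis by (auto simp: H_def)
  qed
  define H1 where "H1 = H \<union> (H #> z)"
  have H1: "subgroup H1 G" unfolding H1_def using H(1) z Hc one by (intro subgroup_extend_comm) auto
  have norm: "\<exists>h'\<in>H1. s \<otimes> h = h' \<otimes> s" if h: "h \<in> H1" for h
  proof -
    have aux: "inv (a [^] k) \<in> H \<and> s \<otimes> a [^] k = inv (a [^] k) \<otimes> s" for k :: nat
      using involutions_invert(1)[OF s t, of k] subgroup.m_inv_closed[OF H(1)]
      by (auto simp: a_def H_def)
    from h consider k :: nat where "h = a [^] k" | k :: nat where "h = a [^] k \<otimes> z"
      by (auto simp: H1_def H_def r_coset_def)
    then show ?thesis
    proof cases
      case 1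
      then show ?thesis using aux[of k] by (auto simp: H1_def)
    next
      case 2
      have "s \<otimes> h = (s \<otimes> a [^] k) \<otimes> z" using 2 s a z by (simp add: m_assoc)
      also have "\<dots> = inv (a [^] k) \<otimes> (s \<otimes> z)" using aux[of k] s a z by (simp add: m_assoc)
      also have "\<dots> = (inv (a [^] k) \<otimes> z) \<otimes> s" using z(1) a s by (simp add: z(3)[symmetric] m_assoc)
      finally show ?thesis
        using aux[of k] by (intro bexI[of _ "inv (a [^] k) \<otimes> z"]) (auto simp: H1_def r_coset_def)
    qed
  qed
  define J where "J = H1 \<union> (H1 #> s)"
  have J: "subgroup J G"
    unfolding J_def using H1 s norm subgroup.one_closed[OF H1] by (intro subgroup_extend) auto
  have "finite J" unfolding J_def H1_def by (intro finite_extend H(2))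
  moreover have sJ: "s \<in> J" unfolding J_def by (rule mem_extend[OF H1 s(1)])
  moreover have "z \<in> J" using mem_extend[OF H(1) z(1)] by (auto simp: J_def H1_def)
  moreover have "a \<in> J"
    using range_eqI[of a "\<lambda>k::nat. a [^] k" 1] a by (auto simp: J_def H1_def H_def)
  then have "s \<otimes> a \<in> J" using J sJ by (simp add: subgroup.m_closed)
  then have "t \<in> J" using s t by (simp add: a_def m_assoc[symmetric])
  ultimately show ?thesis using J by blast
qed

text \<open>Four distinct four-groups on \<open>z\<close> are enough: the one through
  \<open>r\<close> becomes \<open>K\<close>, the other three carry the paths. Only \<open>r\<close>
  with a single \<open>t i\<close> has to lie in a finite subgroup, so dihedral groups suffice and
  no finite group holding all four is asked for.\<close>

lemma finite_commuting_involutions: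
  assumes "planar_group G" "two_group G"
    and z: "z \<in> carrier G" "z \<noteq> \<one>" "z \<otimes> z = \<one>"
  shows "finite {t \<in> carrier G. t \<otimes> t = \<one> \<and> z \<otimes> t = t \<otimes> z}" (is "finite ?S")
proof (rule ccontr)
  assume inf: "infinite ?S"
  have pick: "\<exists>t\<in>?S. t \<notin> F" if "finite F" for F
    using inf that by (meson finite_subset subsetI)
  obtain r where r: "r \<in> ?S" "r \<notin> {\<one>, z}" using pick[of "{\<one>, z}"] by auto
  obtain t0 where t0: "t0 \<in> ?S" "t0 \<notin> {\<one>, z, r, z \<otimes> r}" using pick[of "{\<one>, z, r, z \<otimes> r}"] by auto
  obtain t1 where t1: "t1 \<in> ?S" "t1 \<notin> {\<one>, z, r, z \<otimes> r, t0, z \<otimes> t0}"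
    using pick[of "{\<one>, z, r, z \<otimes> r, t0, z \<otimes> t0}"] by auto
  obtain t2 where t2: "t2 \<in> ?S" "t2 \<notin> {\<one>, z, r, z \<otimes> r, t0, z \<otimes> t0, t1, z \<otimes> t1}"
    using pick[of "{\<one>, z, r, z \<otimes> r, t0, z \<otimes> t0, t1, z \<otimes> t1}"] by auto
  define t where "t i = (if i = 0 then t0 else if i = 1 then t1 else t2)" for i :: nat
  have t: "t i \<in> carrier G \<and> t i \<otimes> t i = \<one> \<and> z \<otimes> t i = t i \<otimes> z \<and> t i \<notin> {\<one>, z}" for i
    using t0 t1 t2 by (auto simp: t_def)
  have zz: "z \<otimes> (z \<otimes> x) = x" if "x \<in> carrier G" for x
    using that z by (metis l_one m_assoc)
  have dist: "t j \<notin> {t i, z \<otimes> t i}" if "i < 3" "j < 3" "i \<noteq> j" for i j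
    using that t0 t1 t2 zz[of t0] zz[of t1] zz[of t2]
    by (auto simp: t_def less_Suc_eq numeral_3_eq_3 split: if_splits)
  define K where "K = {\<one>, z, r, z \<otimes> r}"
  have "subgroup K G"
    using maximal_four_group[OF z, of r] r by (auto simp: K_def maximal_subgroup_of_def)
  have "\<exists>J. subgroup J G \<and> finite J \<and> {r, t i, z} \<subseteq> J" for i
  proof -
    have "r \<otimes> t i \<in> carrier G" using r t by auto
    then obtain n :: nat where n: "(r \<otimes> t i) [^] (2 ^ n :: nat) = \<one>"
      using two_groupD[OF is_group assms(2)] by blast
    then show ?thesis using r t z by (intro finite_subgroup_two_involutions[OF _ _ _ _ _ _ _ _ n]) auto
  qed
  then obtain J where J: "\<And>i::nat. subgroup (J i) G \<and> finite (J i) \<and> {r, t i, z} \<subseteq> J i" by metis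
  have KJ: "K \<subseteq> J i" for i
    using J[of i] subgroup.one_closed[of "J i"] subgroup.m_closed[of "J i"] by (auto simp: K_def)
  have tK: "t i \<notin> K" for i using t0 t1 t2 by (auto simp: t_def K_def)
  have "\<not> planar_group G"
  proof (rule not_planar_three_four_groups[OF z, where t = t and K = K and J = J])
    show "K \<noteq> {\<one>, z}" using r by (auto simp: K_def)
    show "K \<noteq> {\<one>, z, t i, z \<otimes> t i}" for i using tK[of i] by blast
    show "t j \<notin> {t i, z \<otimes> t i}" if "i < 3" "j < 3" "i \<noteq> j" for i j by (rule dist[OF that])
  qed (use t J KJ \<open>subgroup K G\<close> in \<open>auto simp: K_def\<close>)
  then show False using assms(1) by blast
qed

text \<open>Seen from a fixed \<open>z\<close>, every involution is reached by at most two commuting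
  steps, and each step has finitely many choices.\<close>

lemma finite_involutions:
  assumes "planar_group G" "two_group G"
  shows "finite {t \<in> carrier G. t \<otimes> t = \<one>}" (is "finite ?S")
proof (cases "\<exists>z\<in>?S. z \<noteq> \<one>")
  case True
  then obtain z where z: "z \<in> carrier G" "z \<noteq> \<one>" "z \<otimes> z = \<one>" by blast
  define I where "I w = {t \<in> carrier G. t \<otimes> t = \<one> \<and> w \<otimes> t = t \<otimes> w}" for w
  have fin: "finite (I w)" if "w \<in> carrier G" "w \<noteq> \<one>" "w \<otimes> w = \<one>" for w
    unfolding I_def by (rule finite_commuting_involutions[OF assms that])
  have "t \<in> (\<Union>w\<in>I z - {\<one>}. I w)" if t: "t \<in> ?S" for t
  proof -
    have tc: "t \<in> carrier G" "t \<otimes> t = \<one>" using t by auto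
    define a where "a = z \<otimes> t"
    have a: "a \<in> carrier G" using tc z by (simp add: a_def)
    show ?thesis
    proof (cases "z \<otimes> t = t \<otimes> z")
      case True
      then have "t \<in> I z" "z \<in> I z - {\<one>}" using tc z by (auto simp: I_def)
      then show ?thesis by blast
    next
      case False
      have a1: "a \<noteq> \<one>" using False tc z unfolding a_def by (metis inv_equality)
      \<comment> \<open>Minimality makes \<open>w\<close>, the power with exponent
        \<open>2 ^ (n - 1)\<close>, the involution among the powers of \<open>a\<close>. It is
        inverted by \<open>z\<close> and \<open>t\<close> and is its own inverse, so it commutes
        with both.\<close>
      define n where "n = (LEAST n. a [^] (2 ^ n :: nat) = \<one>)"
      have n: "a [^] (2 ^ n :: nat) = \<one>"
        unfolding n_def by (rule LeastI_ex[OF two_groupD[OF is_group assms(2) a]])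
      have "n \<noteq> 0" using n a1 a by (cases n) auto
      then obtain m where m: "n = Suc m" by (cases n) auto
      define w where "w = a [^] (2 ^ m :: nat)"
      have w: "w \<in> carrier G" "w \<noteq> \<one>"
        using a not_less_Least[of m "\<lambda>n. a [^] (2 ^ n :: nat) = \<one>"] m unfolding w_def n_def by auto
      have ww: "w \<otimes> w = \<one>" using n a by (simp add: w_def m nat_pow_mult mult_2)
      then have "inv w = w" using w by (metis inv_equality)
      then have "z \<otimes> w = w \<otimes> z" "t \<otimes> w = w \<otimes> t"
        using involutions_invert[OF z(1,3) tc, of "2 ^ m"] by (auto simp: w_def a_def)
      then have "w \<in> I z - {\<one>}" "t \<in> I w" using w ww tc by (auto simp: I_def)
      then show ?thesis by blast
    qed
  qed
  moreover have "finite (\<Union>w\<in>I z - {\<one>}. I w)"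
    using fin z by (intro finite_UN_I finite_Diff) (auto simp: I_def)
  ultimately show ?thesis by (meson finite_subset subsetI)
next
  case False
  then have "?S \<subseteq> {\<one>}" by blast
  then show ?thesis by (rule finite_subset) simp
qed

text \<open>A root of \<open>y\<close> commutes with \<open>y\<close>, and modulo the powers of
  \<open>y\<close> its square is trivial. There are finitely many such cosets in the quotient of the
  centralizer, and each is finite.\<close>

lemma finite_square_roots:
  assumes "planar_group G" "two_group G" and y: "y \<in> carrier G"
  shows "finite {x \<in> carrier G. x \<otimes> x = y}"
proof -
  define C where "C = centralizer y"
  have C: "subgroup C G" unfolding C_def by (rule subgroup_centralizer[OF y])
  let ?C = "G\<lparr>carrier := C\<rparr>"
  interpret C: group ?C by (rule subgroup_imp_group[OF C])
  define N where "N = range (\<lambda>k::nat. y [^] k)"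
  obtain n :: nat where n: "y [^] (2 ^ n :: nat) = \<one>"
    using two_groupD[OF is_group assms(2) y] by blast
  have N: "subgroup N G" "finite N" using finite_powers[OF y n] by (auto simp: N_def)
  have comm: "y [^] k \<otimes> x = x \<otimes> y [^] k" if "x \<in> C" for x and k :: nat
  proof -
    have x: "x \<in> carrier G" "y \<in> centralizer x"
      using that y by (auto simp: C_def centralizer_def)
    have "y [^] k \<in> centralizer x"
      using x y subgroup.m_closed[OF subgroup_centralizer[OF x(1)]]
        subgroup.one_closed[OF subgroup_centralizer[OF x(1)]] by (induction k) auto
    then show ?thesis by (simp add: centralizer_def)
  qed
  have "N \<subseteq> C"
    using comm[of y] y by (auto simp: N_def C_def centralizer_def)
  then have NC: "subgroup N ?C" by (rule subgroup_incl[OF N(1) C])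
  interpret N: normal N ?C
  proof (rule C.normalI[OF NC])
    show "\<forall>x\<in>carrier ?C. N #>\<^bsub>?C\<^esub> x = x <#\<^bsub>?C\<^esub> N"
      using comm by (auto simp: r_coset_def l_coset_def N_def)
  qed
  let ?Q = "?C Mod N"
  have "finite {Y \<in> carrier ?Q. Y \<otimes>\<^bsub>?Q\<^esub> Y = \<one>\<^bsub>?Q\<^esub>}"
    using assms(1,2) C N.factorgroup_is_group
    by (intro group.finite_involutions N.planar_group_FactGroup N.two_group_FactGroup
        planar_group_subgroup two_group_subgroup)
  moreover have "finite Y" if "Y \<in> carrier ?Q" for Y
    using that N(2) by (auto simp: FactGroup_def RCOSETS_def r_coset_def)
  ultimately have "finite (\<Union>{Y \<in> carrier ?Q. Y \<otimes>\<^bsub>?Q\<^esub> Y = \<one>\<^bsub>?Q\<^esub>})" by blast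
  moreover have "{x \<in> carrier G. x \<otimes> x = y} \<subseteq> \<Union>{Y \<in> carrier ?Q. Y \<otimes>\<^bsub>?Q\<^esub> Y = \<one>\<^bsub>?Q\<^esub>}"
  proof
    fix x assume "x \<in> {x \<in> carrier G. x \<otimes> x = y}"
    then have x: "x \<in> carrier G" "x \<otimes> x = y" by auto
    have xC: "x \<in> carrier ?C" using x by (auto simp: C_def centralizer_def m_assoc)
    have "y \<in> N" using range_eqI[of y "\<lambda>k::nat. y [^] k" 1] y by (auto simp: N_def)
    have "(N #>\<^bsub>?C\<^esub> x) <#>\<^bsub>?C\<^esub> (N #>\<^bsub>?C\<^esub> x) = N #>\<^bsub>?C\<^esub> y"
      using N.rcos_sum[OF xC xC] x by simp
    also have "\<dots> = N" using C.coset_join2[of y N] \<open>y \<in> N\<close> NC \<open>N \<subseteq> C\<close> by auto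
    finally have "N #>\<^bsub>?C\<^esub> x \<in> {Y \<in> carrier ?Q. Y \<otimes>\<^bsub>?Q\<^esub> Y = \<one>\<^bsub>?Q\<^esub>}"
      using xC by (auto simp: FactGroup_def RCOSETS_def)
    moreover have "x \<in> N #>\<^bsub>?C\<^esub> x" by (rule C.rcos_self[OF xC NC])
    ultimately show "x \<in> \<Union>{Y \<in> carrier ?Q. Y \<otimes>\<^bsub>?Q\<^esub> Y = \<one>\<^bsub>?Q\<^esub>}" by blast
  qed
  ultimately show ?thesis by (rule rev_finite_subset)
qed

text \<open>Conjugates share their exponent, so this bound makes conjugacy classes finite. The
  induction takes one square root at a time.\<close>

lemma finite_bounded_exponent:
  assumes "planar_group G" "two_group G"
  shows "finite {x \<in> carrier G. x [^] (2 ^ k :: nat) = \<one>}"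
proof (induction k)
  case 0
  have "{x \<in> carrier G. x [^] (2 ^ 0 :: nat) = \<one>} \<subseteq> {\<one>}" by auto
  then show ?case by (rule finite_subset) simp
next
  case (Suc k)
  have "{x \<in> carrier G. x [^] (2 ^ Suc k :: nat) = \<one>} \<subseteq>
    (\<Union>y\<in>{x \<in> carrier G. x [^] (2 ^ k :: nat) = \<one>}. {x \<in> carrier G. x \<otimes> x = y})"
  proof
    fix x assume "x \<in> {x \<in> carrier G. x [^] (2 ^ Suc k :: nat) = \<one>}"
    then have x: "x \<in> carrier G" "x [^] (2 * 2 ^ k :: nat) = \<one>" by auto
    then have "(x [^] (2::nat)) [^] (2 ^ k :: nat) = \<one>" by (simp add: nat_pow_pow)
    moreover have "x [^] (2::nat) = x \<otimes> x" using x by (simp add: numeral_2_eq_2)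
    ultimately show "x \<in> (\<Union>y\<in>{x \<in> carrier G. x [^] (2 ^ k :: nat) = \<one>}. {x \<in> carrier G. x \<otimes> x = y})"
      using x by auto
  qed
  moreover have "finite \<dots>"
    using Suc finite_square_roots[OF assms] by (intro finite_UN_I) auto
  ultimately show ?case by (rule finite_subset)
qed

end

section \<open>Central quasicyclic subgroups\<close>

context group
begin

text \<open>Iterated squaring leads from \<open>g\<close> to the identity; the last power before the
  first entry into \<open>H\<close> is as required. It plays the part of an involution modulo
  \<open>H\<close>, also where \<open>H\<close> is not known to be normal.\<close>

lemma two_group_descend:
  assumes "two_group G" "subgroup H G" "g \<in> carrier G" "g \<notin> H"
  obtains m :: nat where "g [^] (2 ^ m :: nat) \<notin> H"
    "g [^] (2 ^ m :: nat) \<otimes> g [^] (2 ^ m :: nat) \<in> H"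
proof -
  let ?P = "\<lambda>n::nat. g [^] (2 ^ n :: nat) \<in> H"
  obtain k :: nat where "g [^] (2 ^ k :: nat) = \<one>"
    using two_groupD[OF is_group assms(1,3)] by blast
  then have ex: "\<exists>n. ?P n" using subgroup.one_closed[OF assms(2)] by metis
  define n where "n = (LEAST n. ?P n)"
  have n: "?P n" unfolding n_def by (rule LeastI_ex[OF ex])
  have "n \<noteq> 0" using n assms(3,4) by (intro notI) simp
  then obtain m where m: "n = Suc m" by (cases n) auto
  have "\<not> ?P m" using not_less_Least[of m ?P] m by (simp add: n_def)
  moreover have "g [^] (2 ^ m :: nat) \<otimes> g [^] (2 ^ m :: nat) \<in> H"
    using n m assms(3) by (simp add: nat_pow_mult mult_2)
  ultimately show ?thesis by (rule that)
qed

text \<open>Koenig's lemma for the forest of square roots.\<close>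

lemma quasicyclic_sequence:
  assumes "infinite (carrier G)" "planar_group G" "two_group G"
  obtains c :: "nat \<Rightarrow> 'a" where "\<And>n. c n \<in> carrier G" "\<And>n. c (Suc n) \<otimes> c (Suc n) = c n"
    "c 0 \<noteq> \<one>" "c 0 \<otimes> c 0 = \<one>"
proof -
  \<comment> \<open>\<open>T x\<close> is the tree of iterated square roots of \<open>x\<close>. The
    index in \<open>P\<close> singles out the start, which must be an involution; at
    \<open>\<one>\<close> the tree would be all of the group.\<close>
  define T where "T x = {y \<in> carrier G. \<exists>k::nat. y [^] (2 ^ k :: nat) = x}" for x
  define P where "P n x \<longleftrightarrow> x \<in> carrier G \<and> infinite (T x) \<and> (n = 0 \<longrightarrow> x \<noteq> \<one> \<and> x \<otimes> x = \<one>)"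
    for n :: nat and x
  have "\<exists>x. P 0 x"
  proof (rule ccontr)
    assume no: "\<nexists>x. P 0 x"
    let ?S = "{x \<in> carrier G. x \<otimes> x = \<one>}"
    have "carrier G \<subseteq> {\<one>} \<union> (\<Union>y\<in>?S - {\<one>}. T y)"
    proof
      fix g assume g: "g \<in> carrier G"
      show "g \<in> {\<one>} \<union> (\<Union>y\<in>?S - {\<one>}. T y)"
      proof (cases "g = \<one>")
        case False
        obtain m :: nat where "g [^] (2 ^ m :: nat) \<notin> {\<one>}"
          "g [^] (2 ^ m :: nat) \<otimes> g [^] (2 ^ m :: nat) \<in> {\<one>}"
          by (rule two_group_descend[OF assms(3) triv_subgroup g]) (use False in auto)
        then show ?thesis using g by (auto simp: T_def)
      qed simp
    qed
    moreover have "finite ({\<one>} \<union> (\<Union>y\<in>?S - {\<one>}. T y))"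
      using no finite_involutions[OF assms(2,3)] by (auto simp: P_def)
    ultimately show False using assms(1) finite_subset by blast
  qed
  moreover have "\<exists>y. P (Suc n) y \<and> y \<otimes> y = x" if x: "P n x" for n x
  proof (rule ccontr)
    assume no: "\<nexists>y. P (Suc n) y \<and> y \<otimes> y = x"
    have "T x \<subseteq> {x} \<union> (\<Union>y\<in>{y \<in> carrier G. y \<otimes> y = x}. T y)"
    proof
      fix g assume "g \<in> T x"
      then obtain k :: nat where g: "g \<in> carrier G" "g [^] (2 ^ k :: nat) = x"
        by (auto simp: T_def)
      show "g \<in> {x} \<union> (\<Union>y\<in>{y \<in> carrier G. y \<otimes> y = x}. T y)"
      proof (cases k)
        case (Suc m)
        then have "g [^] (2 ^ m :: nat) \<otimes> g [^] (2 ^ m :: nat) = x"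
          using g by (simp add: nat_pow_mult mult_2)
        then show ?thesis using g by (auto simp: T_def)
      qed (use g in simp)
    qed
    moreover have "finite ({x} \<union> (\<Union>y\<in>{y \<in> carrier G. y \<otimes> y = x}. T y))"
      using no finite_square_roots[OF assms(2,3)] x by (auto simp: P_def)
    ultimately show False using x finite_subset unfolding P_def by blast
  qed
  ultimately obtain c where "\<And>n. P n (c n)" "\<And>n. c (Suc n) \<otimes> c (Suc n) = c n"
    using dependent_nat_choice[of P "\<lambda>_ x y. y \<otimes> y = x"] by metis
  then show ?thesis by (intro that[of c]) (auto simp: P_def)
qed

text \<open>For each \<open>g\<close>, two conjugates of \<open>g\<close> by members \<open>c i\<close>, \<open>c k\<close> of the sequence agree. As
  \<open>c i = c k [^] 2 ^ d\<close>, an odd power of \<open>c k\<close> centralizes \<open>g\<close>, hence so does \<open>c k\<close>.\<close>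

lemma quasicyclic_sequence_central:
  assumes "planar_group G" "two_group G"
    and c: "\<And>n. c n \<in> carrier G" "\<And>n. c (Suc n) \<otimes> c (Suc n) = c n" "c 0 \<otimes> c 0 = \<one>"
    and g: "g \<in> carrier G"
  shows "c j \<in> centralizer g"
proof -
  have down: "c (j + d) [^] (2 ^ d :: nat) = c j" for j d
  proof (induction d)
    case (Suc d)
    have "c (j + Suc d) [^] (2 ^ Suc d :: nat) = (c (Suc (j + d)) [^] (2::nat)) [^] (2 ^ d :: nat)"
      using c(1) by (simp add: nat_pow_pow)
    also have "\<dots> = c j" using Suc c by (simp add: numeral_2_eq_2)
    finally show ?case .
  qed (use c in simp)
  have ord: "c k [^] (2 ^ Suc k :: nat) = \<one>" for k
    using down[of 0 k] c by (simp add: mult_2 nat_pow_mult[symmetric])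
  obtain n :: nat where n: "g [^] (2 ^ n :: nat) = \<one>"
    using two_groupD[OF is_group assms(2) g] by blast
  have conj: "(x \<otimes> g \<otimes> inv x) [^] m = x \<otimes> g [^] m \<otimes> inv x" if "x \<in> carrier G" for x and m :: nat
  proof (induction m)
    case (Suc m)
    have "inv x \<otimes> (x \<otimes> w) = w" if "w \<in> carrier G" for w
      using that \<open>x \<in> carrier G\<close> by (simp add: m_assoc[symmetric])
    then show ?case using that g Suc by (simp add: m_assoc)
  qed (use that in simp)
  define f where "f k = c k \<otimes> g \<otimes> inv (c k)" for k
  \<comment> \<open>Only indices from \<open>j\<close> on are compared, so that \<open>c j\<close>
    is a power of the \<open>c k\<close> that is found.\<close>
  have "f ` {j..} \<subseteq> {x \<in> carrier G. x [^] (2 ^ n :: nat) = \<one>}"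
    using conj[OF c(1)] c(1) g n by (auto simp: f_def)
  then have "finite (f ` {j..})"
    using finite_bounded_exponent[OF assms(1,2)] finite_subset by blast
  then have "\<not> inj_on f {j..}" using finite_imageD infinite_Ici by blast
  then obtain i k where ik: "j \<le> i" "i < k" "f i = f k"
    by (auto simp: inj_on_def) (metis linorder_neqE_nat)
  define d where "d = k - i"
  have d: "0 < d" "c i = c k [^] (2 ^ d :: nat)" using ik down[of i d] by (auto simp: d_def)
  \<comment> \<open>Removing one factor \<open>c k\<close> from \<open>c i = c k [^] 2 ^ d\<close>
    leaves the exponent \<open>N\<close>. This factor also cancels from the equal conjugates, and
    \<open>N\<close> is odd because \<open>d\<close> is positive.\<close>
  define N :: nat where "N = 2 ^ d - 1"
  have N: "Suc N = 2 ^ d" by (simp add: N_def)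
  let ?v = "c k [^] N"
  have v: "?v \<in> carrier G" "c i = c k \<otimes> ?v"
    using c(1) d(2) nat_pow_Suc2[OF c(1)[of k], of N] by (simp_all add: N)
  have "c k \<otimes> (?v \<otimes> g \<otimes> inv ?v) \<otimes> inv (c k) = c k \<otimes> g \<otimes> inv (c k)"
    using ik(3) c(1)[of k] g v by (simp add: f_def inv_mult_group m_assoc)
  then have "?v \<otimes> g \<otimes> inv ?v = g"
    using c(1)[of k] g v(1) by simp
  then have "?v \<otimes> g = g \<otimes> ?v"
    using g v(1) by (metis inv_solve_right m_closed)
  then have "?v \<in> centralizer g" using v(1) by (simp add: centralizer_def)
  then have pow: "?v [^] r \<in> centralizer g" for r :: nat
    using subgroup.m_closed[OF subgroup_centralizer[OF g]] subgroup.one_closed[OF subgroup_centralizer[OF g]]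
    by (induction r) auto
  have "odd N" using d(1) by (simp add: N_def)
  then have "coprime N (2 ^ Suc k)" by simp
  moreover have "N \<noteq> 0" using \<open>odd N\<close> by (intro notI) simp
  \<comment> \<open>\<open>r\<close> inverts \<open>N\<close> modulo \<open>2 ^ Suc k\<close>, an
    exponent that kills \<open>c k\<close>, so \<open>c k\<close> is recovered from its odd
    power.\<close>
  ultimately obtain r q where rq: "N * r = 2 ^ Suc k * q + 1"
    using bezout_nat[of N "2 ^ Suc k"] by auto
  have "?v [^] r = c k [^] (2 ^ Suc k * q + 1)"
    using c(1) by (simp add: nat_pow_pow rq)
  also have "\<dots> = (c k [^] (2 ^ Suc k :: nat)) [^] q \<otimes> c k"
    using c(1) by (simp add: nat_pow_pow del: power_Suc)
  also have "\<dots> = c k" using c(1) by (simp add: ord del: power_Suc)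
  finally have "c k \<in> centralizer g" using pow by metis
  then have "c k [^] r \<in> centralizer g" for r :: nat
    using subgroup.m_closed[OF subgroup_centralizer[OF g]] subgroup.one_closed[OF subgroup_centralizer[OF g]]
    by (induction r) auto
  then show ?thesis using down[of j "k - j"] ik by (metis le_add_diff_inverse less_imp_le le_trans)
qed

end

text \<open>The quasicyclic group enters through four features: it is central, it contains square
  roots of its elements, it has an involution \<open>z\<close>, and each of its elements lies with
  \<open>z\<close> in a finite subgroup. Roots correct squares; the finite subgroups feed the
  nonplanarity criteria.\<close>

locale central_quasicyclic = group G for G (structure) +
  fixes P :: "'a set" and z :: 'a
  assumes planar: "planar_group G" and two: "two_group G"
    and P: "subgroup P G" and central: "\<lbrakk>p \<in> P; g \<in> carrier G\<rbrakk> \<Longrightarrow> p \<otimes> g = g \<otimes> p"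
    and divisible: "p \<in> P \<Longrightarrow> \<exists>q\<in>P. q \<otimes> q = p"
    and z: "z \<in> P" "z \<noteq> \<one>" "z \<otimes> z = \<one>"
    and loc_finite: "q \<in> P \<Longrightarrow> \<exists>K. subgroup K G \<and> finite K \<and> {z, q} \<subseteq> K \<and> K \<subseteq> P"
begin

section \<open>Involutions modulo the central subgroup\<close>

lemma PG: "p \<in> P \<Longrightarrow> p \<in> carrier G"
  using subgroup.mem_carrier[OF P] .

lemma P_inv: "p \<in> P \<Longrightarrow> inv p \<in> P"
  using subgroup.m_inv_closed[OF P] .

lemma P_mult: "\<lbrakk>p \<in> P; q \<in> P\<rbrakk> \<Longrightarrow> p \<otimes> q \<in> P"
  using subgroup.m_closed[OF P] .

lemma P_centralizer: "g \<in> carrier G \<Longrightarrow> P \<subseteq> centralizer g"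
  using central PG by (auto simp: centralizer_def)

lemma P_cancel_right:
  assumes "g \<in> carrier G" "p \<in> P" "g \<otimes> p \<in> P"
  shows "g \<in> P"
proof -
  have "g = (g \<otimes> p) \<otimes> inv p" using assms PG by (simp add: m_assoc)
  then show ?thesis using P_mult[OF assms(3) P_inv[OF assms(2)]] by simp
qed

text \<open>The elements commute up to \<open>e\<close>, which is also the square of
  \<open>t1 \<otimes> t2\<close>; a root \<open>q\<close> of \<open>inv e\<close> corrects this
  product to a third involution. The three involutions lie in different nontrivial cosets of
  \<open>P\<close>, so their four-groups with \<open>z\<close> differ, and a finite subgroup of
  \<open>P\<close> holding \<open>z\<close> and \<open>q\<close>, extended by \<open>t1\<close> and
  \<open>t2\<close>, contains them all.\<close>

lemma no_involution_pair:
  assumes t: "t1 \<in> carrier G" "t1 \<otimes> t1 = \<one>" "t2 \<in> carrier G" "t2 \<otimes> t2 = \<one>"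
    and out: "t1 \<notin> P" "t2 \<notin> P" "t1 \<otimes> t2 \<notin> P"
    and e: "e \<in> P" "t1 \<otimes> t2 = e \<otimes> (t2 \<otimes> t1)"
  shows False
proof -
  have eG: "e \<in> carrier G" and zG: "z \<in> carrier G" using e z PG by auto
  obtain q where q: "q \<in> P" "q \<otimes> q = inv e" using divisible P_inv e(1) by blast
  have qG: "q \<in> carrier G" using q PG by auto
  define t3 where "t3 = t1 \<otimes> t2 \<otimes> q"
  have t3G: "t3 \<in> carrier G" using t qG by (simp add: t3_def)
  have "(e \<otimes> (t2 \<otimes> t1)) \<otimes> (t1 \<otimes> t2) = e \<otimes> (t2 \<otimes> (t1 \<otimes> t1) \<otimes> t2)"
    using t(1,3) eG by (simp only: m_assoc m_closed)
  also have "\<dots> = e" using t eG by simp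
  finally have "(t1 \<otimes> t2) \<otimes> (t1 \<otimes> t2) = e" by (simp only: e(2)[symmetric])
  moreover have "(t1 \<otimes> t2) \<otimes> q = q \<otimes> (t1 \<otimes> t2)" using central[OF q(1), of "t1 \<otimes> t2"] t by simp
  ultimately have t3: "t3 \<otimes> t3 = \<one>"
    using comm_square[of "t1 \<otimes> t2" q] t qG q(2) eG by (simp add: t3_def)
  have t3P: "t3 \<notin> P" using P_cancel_right[of "t1 \<otimes> t2" q] q(1) out(3) t by (auto simp: t3_def)
  define t where "t i = (if i = 0 then t1 else if i = 1 then t2 else t3)" for i :: nat
  have tG: "t i \<in> carrier G" "t i \<otimes> t i = \<one>" "t i \<notin> P" for i
    using assms(1-6) t3G t3 t3P by (auto simp: t_def)
  have n12: "t2 \<noteq> p \<otimes> t1" if p: "p \<in> P" for p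
  proof
    assume "t2 = p \<otimes> t1"
    then have "t1 \<otimes> t2 = p \<otimes> (t1 \<otimes> t1)" using central[OF p assms(1)] PG[OF p] assms(1) by (metis m_assoc)
    then show False using out(3) p PG[OF p] assms(2) by simp
  qed
  have n13: "t3 \<noteq> p \<otimes> t1" if p: "p \<in> P" for p
  proof
    assume "t3 = p \<otimes> t1"
    then have "t1 \<otimes> (t2 \<otimes> q) = t1 \<otimes> p" using central[OF p assms(1)] assms(1,3) qG by (simp add: t3_def m_assoc)
    then have "t2 \<otimes> q \<in> P" using p PG[OF p] assms(1,3) qG by simp
    then show False using P_cancel_right q(1) out(2) assms(3) by blast
  qed
  have n23: "t3 \<noteq> p \<otimes> t2" if p: "p \<in> P" for p
  proof
    assume "t3 = p \<otimes> t2"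
    then have "(t1 \<otimes> q) \<otimes> t2 = p \<otimes> t2"
      using central[OF q(1) assms(3)] assms(1,3) qG by (simp add: t3_def m_assoc)
    then have "t1 \<otimes> q \<in> P" using p PG[OF p] assms(1,3) qG by simp
    then show False using P_cancel_right q(1) out(1) assms(1) by blast
  qed
  have lt: "t j \<noteq> p \<otimes> t i" if "i < j" "j < 3" "p \<in> P" for i j p
    using that n12 n13 n23 by (auto simp: t_def numeral_3_eq_3 less_Suc_eq)
  have ne: "t j \<noteq> p \<otimes> t i" if ij: "i < 3" "j < 3" "i \<noteq> j" and p: "p \<in> P" for i j p
  proof (cases "i < j")
    case False
    show ?thesis
    proof
      assume "t j = p \<otimes> t i"
      then have "t i = inv p \<otimes> t j" using tG PG[OF p] by (simp add: m_assoc[symmetric])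
      then show False using lt[of j i "inv p"] P_inv[OF p] ij False by simp
    qed
  qed (use lt ij p in simp)
  have oneP: "\<one> \<in> P" using P by (rule subgroup.one_closed)
  obtain K where K: "subgroup K G" "finite K" "{z, q} \<subseteq> K" "K \<subseteq> P" using loc_finite[OF q(1)] by blast
  have oneK: "\<one> \<in> K" using K(1) by (rule subgroup.one_closed)
  define U1 where "U1 = K \<union> (K #> t1)"
  have U1: "subgroup U1 G"
    unfolding U1_def using K P_centralizer[OF assms(1)] assms(1,2) oneK
    by (intro subgroup_extend_comm) auto
  have norm: "\<exists>h'\<in>U1. t2 \<otimes> h = h' \<otimes> t2" if "h \<in> U1" for h
  proof -
    from that consider "h \<in> K" | k where "k \<in> K" "h = k \<otimes> t1" by (auto simp: U1_def r_coset_def)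
    then show ?thesis
    proof cases
      case 1
      then have "t2 \<otimes> h = h \<otimes> t2" using central[of h t2] K(4) assms(3) by auto
      then show ?thesis using that by blast
    next
      case 2
      have kP: "k \<in> P" "k \<in> carrier G" using 2 K PG by auto
      have "t2 \<otimes> t1 = inv e \<otimes> (t1 \<otimes> t2)"
        unfolding e(2) using eG assms(1,3) by (simp add: m_assoc[symmetric])
      then have "k \<otimes> (t2 \<otimes> t1) = (k \<otimes> inv e \<otimes> t1) \<otimes> t2"
        using eG assms(1,3) kP by (simp add: m_assoc)
      moreover have "t2 \<otimes> h = k \<otimes> (t2 \<otimes> t1)"
        using 2(2) central[OF kP(1) assms(3)] kP assms(1,3) by (metis m_assoc)
      \<comment> \<open>Moving \<open>t2\<close> past \<open>t1\<close> costs the factor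
        \<open>inv e\<close>; it stays in \<open>K\<close> because \<open>K\<close> was chosen to
        contain its root \<open>q\<close>.\<close>
      moreover have "k \<otimes> inv e \<in> K"
        unfolding q(2)[symmetric] using 2 K(1,3) by (simp add: subgroup.m_closed)
      ultimately show ?thesis by (intro bexI[of _ "k \<otimes> inv e \<otimes> t1"]) (auto simp: U1_def r_coset_def)
    qed
  qed
  define U where "U = U1 \<union> (U1 #> t2)"
  have U: "subgroup U G"
    unfolding U_def using U1 assms(3,4) norm subgroup.one_closed[OF U1] by (intro subgroup_extend) auto
  have "finite U" unfolding U_def U1_def by (intro finite_extend K(2))
  have mem: "t1 \<in> U" "t2 \<in> U" "q \<in> U" "z \<in> U"
    using mem_extend[OF K(1) assms(1)] mem_extend[OF U1 assms(3)] K(3) by (auto simp: U_def U1_def)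
  then have tU: "t i \<in> U" for i
    using U by (auto simp: t_def t3_def subgroup.m_closed)
  have "\<not> planar_group G"
  proof (rule not_planar_three_four_groups[OF zG z(2,3), where t = t and K = U and J = "\<lambda>_. U"])
    show "t i \<in> carrier G \<and> t i \<otimes> t i = \<one> \<and> z \<otimes> t i = t i \<otimes> z \<and> t i \<notin> {\<one>, z}" for i
      using tG[of i] central[OF z(1), of "t i"] oneP z(1) by auto
    show "t j \<notin> {t i, z \<otimes> t i}" if "i < 3" "j < 3" "i \<noteq> j" for i j
      using ne[OF that oneP] ne[OF that z(1)] tG(1)[of i] by simp
    show "U \<noteq> {\<one>, z}" using mem(1) out(1) oneP z(1) by auto
    show "U \<noteq> {\<one>, z, t i, z \<otimes> t i}" if "i < 3" for i
    proof
      assume eq: "U = {\<one>, z, t i, z \<otimes> t i}"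
      \<comment> \<open>Any index other than \<open>i\<close> serves: the four-group of
        \<open>z\<close> and \<open>t i\<close> has no room for \<open>t j\<close>.\<close>
      define j :: nat where "j = (if i = 0 then 1 else 0)"
      have j: "j < 3" "i \<noteq> j" by (auto simp: j_def)
      have "t j \<in> {\<one>, z, t i, z \<otimes> t i}" using tU eq by blast
      then show False
        using ne[OF that j oneP] ne[OF that j z(1)] tG(1)[of i] tG(3)[of j] oneP z(1) by auto
    qed
  qed (use U \<open>finite U\<close> mem tU in auto)
  then show False using planar by blast
qed

text \<open>Roots in the central subgroup allow an involution modulo \<open>P\<close> to be lifted
  to a genuine one: a root of the inverse square cancels the square.\<close>

lemma adjust_to_involution:
  assumes "y \<in> carrier G" "y \<otimes> y \<in> P" "y \<notin> P"
  obtains q where "q \<in> P" "(y \<otimes> q) \<otimes> (y \<otimes> q) = \<one>" "y \<otimes> q \<notin> P" "q \<otimes> q = inv (y \<otimes> y)"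
proof -
  obtain q where q: "q \<in> P" "q \<otimes> q = inv (y \<otimes> y)"
    using divisible P_inv assms(2) by blast
  have "(y \<otimes> q) \<otimes> (y \<otimes> q) = \<one>"
    using comm_square[of y q] central[OF q(1) assms(1)] PG[OF q(1)] assms(1) q(2) by simp
  moreover have "y \<otimes> q \<notin> P" using P_cancel_right[OF assms(1) q(1)] assms(3) by blast
  ultimately show ?thesis using that q by blast
qed

text \<open>If the rotation \<open>s \<otimes> t\<close> is outside \<open>P\<close>, some power of
  it corrects to an involution \<open>y \<otimes> q\<close> outside \<open>P\<close>. Since
  \<open>t\<close> inverts \<open>y\<close>, the elements \<open>t\<close> and
  \<open>y \<otimes> q\<close> commute modulo \<open>P\<close> and form a forbidden pair, unless
  their product lies in \<open>P\<close>; in that case \<open>s\<close> and \<open>t\<close> are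
  themselves such a pair.\<close>

lemma involution_product:
  assumes s: "s \<in> carrier G" "s \<otimes> s = \<one>" "s \<notin> P" and t: "t \<in> carrier G" "t \<otimes> t = \<one>" "t \<notin> P"
  shows "s \<otimes> t \<in> P"
proof (rule ccontr)
  assume aP: "s \<otimes> t \<notin> P"
  let ?a = "s \<otimes> t"
  have a: "?a \<in> carrier G" using s t by simp
  obtain m :: nat where m: "?a [^] (2 ^ m :: nat) \<notin> P"
    "?a [^] (2 ^ m :: nat) \<otimes> ?a [^] (2 ^ m :: nat) \<in> P"
    by (rule two_group_descend[OF two P a aP])
  define y where "y = ?a [^] (2 ^ m :: nat)"
  have y: "y \<in> carrier G" "y \<notin> P" "y \<otimes> y \<in> P" using a m by (auto simp: y_def)
  obtain q where q: "q \<in> P" "(y \<otimes> q) \<otimes> (y \<otimes> q) = \<one>" "y \<otimes> q \<notin> P" "q \<otimes> q = inv (y \<otimes> y)"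
    by (rule adjust_to_involution[OF y(1,3,2)])
  have qG: "q \<in> carrier G" using PG q by blast
  have ty: "t \<otimes> y = inv y \<otimes> t"
    using involutions_invert(2)[OF s(1,2) t(1,2), of "2 ^ m"] by (simp add: y_def)
  show False
  proof (cases "t \<otimes> (y \<otimes> q) \<in> P")
    case False
    have "inv (y \<otimes> y) \<otimes> ((y \<otimes> q) \<otimes> t) = inv y \<otimes> (q \<otimes> t)"
      using y(1) qG t(1) by (simp add: inv_mult_group m_assoc[symmetric])
        (simp add: m_assoc)
    also have "\<dots> = inv y \<otimes> t \<otimes> q"
      using central[OF q(1) t(1)] y(1) qG t(1) by (simp add: m_assoc)
    also have "\<dots> = t \<otimes> (y \<otimes> q)" using y(1) qG t(1) by (simp add: ty[symmetric] m_assoc)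
    finally have "t \<otimes> (y \<otimes> q) = inv (y \<otimes> y) \<otimes> ((y \<otimes> q) \<otimes> t)" by simp
    then show False
      using no_involution_pair[of t "y \<otimes> q" "inv (y \<otimes> y)"] t q y qG P_inv False by simp
  next
    case True
    \<comment> \<open>Here \<open>t\<close> is a central element times the inverse of
      \<open>y \<otimes> q\<close>, and \<open>y\<close> is a power of \<open>?a\<close>. So
      \<open>t\<close> commutes with \<open>s \<otimes> t\<close>, hence with
      \<open>s\<close>.\<close>
    have "y \<in> centralizer ?a"
      using a nat_pow_comm[OF a, of "2 ^ m" 1] by (simp add: y_def centralizer_def)
    moreover have "q \<in> centralizer ?a" "t \<otimes> (y \<otimes> q) \<in> centralizer ?a"
      using P_centralizer[OF a] q(1) True by auto
    ultimately have "(t \<otimes> (y \<otimes> q)) \<otimes> inv (y \<otimes> q) \<in> centralizer ?a"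
      by (meson a subgroup.m_closed subgroup.m_inv_closed subgroup_centralizer)
    then have "t \<in> centralizer ?a" using t(1) y(1) qG by (simp add: m_assoc del: inv_mult_group)
    then have "t \<otimes> (s \<otimes> t) = s \<otimes> (t \<otimes> t)"
      using s(1) t(1) by (simp add: centralizer_def m_assoc)
    then have "t \<otimes> s \<otimes> t = s" using s(1) t(1,2) by (simp add: m_assoc)
    then have "t \<otimes> s \<otimes> (t \<otimes> t) = s \<otimes> t" using s(1) t(1) by (metis m_assoc m_closed)
    then have "s \<otimes> t = \<one> \<otimes> (t \<otimes> s)" using s(1) t(1,2) by simp
    then show False
      using no_involution_pair[OF s(1,2) t(1,2) s(3) t(3) aP subgroup.one_closed[OF P]] by blast
  qed
qed

lemma is_comm_group: "comm_group G"
proof -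
  have comm: "comm_group G" if "\<And>x y. \<lbrakk>x \<in> carrier G; y \<in> carrier G\<rbrakk> \<Longrightarrow> x \<otimes> y = y \<otimes> x"
    using group_comm_groupI that by blast
  show ?thesis
  proof (cases "carrier G \<subseteq> P")
    case True
    then show ?thesis using central by (intro comm) blast
  next
    case False
    then obtain g where g: "g \<in> carrier G" "g \<notin> P" by blast
    obtain m :: nat where m: "g [^] (2 ^ m :: nat) \<notin> P"
      "g [^] (2 ^ m :: nat) \<otimes> g [^] (2 ^ m :: nat) \<in> P"
      by (rule two_group_descend[OF two P g])
    obtain q where q: "q \<in> P" "(g [^] (2 ^ m :: nat) \<otimes> q) \<otimes> (g [^] (2 ^ m :: nat) \<otimes> q) = \<one>"
      "g [^] (2 ^ m :: nat) \<otimes> q \<notin> P"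
      by (rule adjust_to_involution[OF nat_pow_closed[OF g(1)] m(2,1)])
    define t where "t = g [^] (2 ^ m :: nat) \<otimes> q"
    have t: "t \<in> carrier G" "t \<otimes> t = \<one>" "t \<notin> P" using q PG[OF q(1)] g by (auto simp: t_def)
    define Q where "Q = P \<union> (P #> t)"
    have Q: "subgroup Q G"
      unfolding Q_def using P t P_centralizer[OF t(1)] subgroup.one_closed[OF P]
      by (intro subgroup_extend_comm) auto
    show ?thesis
    proof (cases "carrier G \<subseteq> Q")
      case True
      \<comment> \<open>As \<open>Q\<close> is everything, \<open>t\<close> is central; together
        with the central \<open>P\<close> it generates \<open>Q\<close>, which is thus
        abelian.\<close>
      have "Q \<subseteq> centralizer t"
        unfolding Q_def using t by (intro extend_subset_centralizer P_centralizer) (auto simp: centralizer_def)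
      then have "t \<in> centralizer x" if "x \<in> carrier G" for x
        using True that by (meson centralizer_sym subsetD t(1))
      then have "Q \<subseteq> centralizer x" if "x \<in> carrier G" for x
        unfolding Q_def using that by (intro extend_subset_centralizer P_centralizer) auto
      then show ?thesis using True by (intro comm) (auto simp: centralizer_def)
    next
      case False
      then obtain h where h: "h \<in> carrier G" "h \<notin> Q" by blast
      obtain n :: nat where n: "h [^] (2 ^ n :: nat) \<notin> Q"
        "h [^] (2 ^ n :: nat) \<otimes> h [^] (2 ^ n :: nat) \<in> Q"
        by (rule two_group_descend[OF two Q h])
      define x where "x = h [^] (2 ^ n :: nat)"
      have x: "x \<in> carrier G" "x \<notin> Q" "x \<otimes> x \<in> Q" using h n by (auto simp: x_def)
      \<comment> \<open>Otherwise \<open>x\<close> corrects to an involution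
        \<open>x \<otimes> r\<close> outside \<open>P\<close>, whose product with \<open>t\<close>
        lies in \<open>P\<close>; this would put \<open>x\<close> into \<open>Q\<close>.\<close>
      have "x \<otimes> x \<notin> P"
      proof
        assume xx: "x \<otimes> x \<in> P"
        obtain r where r: "r \<in> P" "(x \<otimes> r) \<otimes> (x \<otimes> r) = \<one>" "x \<otimes> r \<notin> P"
          by (rule adjust_to_involution[OF x(1) xx]) (use x(2) Q_def in auto)
        have "x \<otimes> r \<otimes> t \<in> P"
          using involution_product[OF _ r(2,3) t] x(1) PG[OF r(1)] by simp
        then have "(x \<otimes> r \<otimes> t) \<in> Q" "t \<in> Q" "r \<in> Q"
          using mem_extend[OF P t(1)] r(1) by (auto simp: Q_def)
        then have "(x \<otimes> r \<otimes> t) \<otimes> inv t \<otimes> inv r \<in> Q"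
          by (meson Q subgroup.m_closed subgroup.m_inv_closed)
        then show False using x PG[OF r(1)] t(1) by (simp add: m_assoc)
      qed
      then obtain p where p: "p \<in> P" "x \<otimes> x = p \<otimes> t" using x(3) by (auto simp: Q_def r_coset_def)
      \<comment> \<open>A root of \<open>inv p\<close> removes the factor in \<open>P\<close>, so
        that the square of \<open>y\<close> is exactly \<open>t\<close>.\<close>
      obtain r where r: "r \<in> P" "r \<otimes> r = inv p" using divisible P_inv p(1) by blast
      have rG: "r \<in> carrier G" "p \<in> carrier G" using PG r p by auto
      define y where "y = x \<otimes> r"
      have y: "y \<in> carrier G" using x rG by (simp add: y_def)
      have "y \<otimes> y = (x \<otimes> x) \<otimes> (r \<otimes> r)"
        unfolding y_def using central[OF r(1) x(1)] x(1) rG by (intro comm_square) auto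
      also have "\<dots> = p \<otimes> (t \<otimes> inv p)" using p(2) r(2) rG t(1) by (simp add: m_assoc)
      also have "t \<otimes> inv p = inv p \<otimes> t" using central[OF P_inv[OF p(1)] t(1)] by simp
      finally have yy: "y \<otimes> y = t" using rG t(1) by (simp add: m_assoc[symmetric])
      \<comment> \<open>\<open>w\<close> is central, and the squares \<open>z\<close> of
        \<open>w\<close> and \<open>t\<close> of \<open>y\<close> are distinct involutions because
        \<open>t\<close> is outside \<open>P\<close>: the forbidden pair of elements of order
        4.\<close>
      obtain w where w: "w \<in> P" "w \<otimes> w = z" using divisible z(1) by blast
      have "\<not> planar_group G"
        using w z yy t y central[OF w(1) y] PG subgroup.one_closed[OF P]
        by (intro not_planar_order_four_pair[of w y z t]) auto
      then show ?thesis using planar by blast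
    qed
  qed
qed

end

text \<open>\<open>P\<close> is the union of the ascending finite cyclic groups generated by the
  \<open>c n\<close>. A root of \<open>c n [^] i\<close> is \<open>c (Suc n) [^] i\<close>, and each
  group of the chain is itself a finite subgroup containing the involution
  \<open>c 0\<close>.\<close>

lemma (in group) central_quasicyclic_ex:
  assumes "infinite (carrier G)" "two_group G" "planar_group G"
  shows "\<exists>P z. central_quasicyclic G P z"
proof -
  obtain c :: "nat \<Rightarrow> 'a" where c: "\<And>n. c n \<in> carrier G" "\<And>n. c (Suc n) \<otimes> c (Suc n) = c n"
    "c 0 \<noteq> \<one>" "c 0 \<otimes> c 0 = \<one>"
    using quasicyclic_sequence[OF assms(1,3,2)] by blast
  define H where "H n = range (\<lambda>i::nat. c n [^] i)" for n
  have cH: "c n \<in> H n" for n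
    using range_eqI[of "c n" "\<lambda>i::nat. c n [^] i" 1] c(1) by (simp add: H_def)
  have H: "subgroup (H n) G" "finite (H n)" for n
  proof -
    obtain k :: nat where k: "c n [^] (2 ^ k :: nat) = \<one>"
      using two_groupD[OF is_group assms(2) c(1)] by blast
    show "subgroup (H n) G" "finite (H n)"
      unfolding H_def using finite_powers[OF c(1) k] by simp_all
  qed
  have H_sub: "H n \<subseteq> K" if "subgroup K G" "c n \<in> K" for n K
  proof -
    have "c n [^] i \<in> K" for i :: nat
      using that by (induction i) (auto intro: subgroup.m_closed subgroup.one_closed)
    then show ?thesis by (auto simp: H_def)
  qed
  have "H n \<subseteq> H (Suc n)" for n
    using H_sub[OF H(1)] subgroup.m_closed[OF H(1) cH[of "Suc n"] cH[of "Suc n"]] c(2) by simp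
  then have mono: "m \<le> n \<Longrightarrow> H m \<subseteq> H n" for m n
    by (rule lift_Suc_mono_le)
  have cent: "H n \<subseteq> centralizer g" if "g \<in> carrier G" for g n
    by (rule H_sub[OF subgroup_centralizer[OF that]
        quasicyclic_sequence_central[OF assms(3,2) c(1,2,4) that]])
  define P where "P = (\<Union>n. H n)"
  have "central_quasicyclic G P (c 0)"
  proof (intro central_quasicyclic.intro central_quasicyclic_axioms.intro)
    show "group G" by (rule is_group)
    show "planar_group G" "two_group G" "c 0 \<noteq> \<one>" "c 0 \<otimes> c 0 = \<one>" by (fact assms c)+
    show "c 0 \<in> P" using cH by (auto simp: P_def)
    show "subgroup P G"
    proof (rule subgroupI)
      show "P \<subseteq> carrier G" using subgroup.subset[OF H(1)] by (auto simp: P_def)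
      show "P \<noteq> {}" using cH by (auto simp: P_def)
      show "inv a \<in> P" if "a \<in> P" for a
        using that subgroup.m_inv_closed[OF H(1)] by (auto simp: P_def)
      show "a \<otimes> b \<in> P" if ab: "a \<in> P" "b \<in> P" for a b
      proof -
        obtain m n where "a \<in> H m" "b \<in> H n" using ab by (auto simp: P_def)
        then have "a \<in> H (max m n)" "b \<in> H (max m n)"
          using mono[of m "max m n"] mono[of n "max m n"] by auto
        then have "a \<otimes> b \<in> H (max m n)" by (rule subgroup.m_closed[OF H(1)])
        then show ?thesis by (auto simp: P_def)
      qed
    qed
    show "p \<otimes> g = g \<otimes> p" if "p \<in> P" "g \<in> carrier G" for p g
      using that cent[OF that(2)] by (auto simp: P_def centralizer_def)
    show "\<exists>q\<in>P. q \<otimes> q = p" if p: "p \<in> P" for p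
    proof -
      obtain n and i :: nat where "p = c n [^] i" using p by (auto simp: P_def H_def)
      moreover have "c (Suc n) [^] i \<otimes> c (Suc n) [^] i = (c (Suc n) [^] (2::nat)) [^] i"
        using c(1) by (simp add: nat_pow_mult nat_pow_pow mult_2)
      moreover have "c (Suc n) [^] (2::nat) = c n" using c(1,2) by (simp add: numeral_2_eq_2)
      moreover have "c (Suc n) [^] i \<in> P" by (auto simp: P_def H_def)
      ultimately show ?thesis by auto
    qed
    show "\<exists>K. subgroup K G \<and> finite K \<and> {c 0, q} \<subseteq> K \<and> K \<subseteq> P" if q: "q \<in> P" for q
    proof -
      obtain n where "q \<in> H n" using q by (auto simp: P_def)
      then show ?thesis using H[of n] mono[of 0 n] cH[of 0] by (intro exI[of _ "H n"]) (auto simp: P_def)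
    qed
  qed
  then show ?thesis by blast
qed

theorem theorem3p13:
  fixes G :: "('a, 'b) monoid_scheme"
  assumes "group G"
    and "infinite (carrier G)"
    and "two_group G"
    and "planar_group G"
  shows "comm_group G"
proof -
  obtain P z where "central_quasicyclic G P z"
    using group.central_quasicyclic_ex[OF assms(1-4)] by blast
  then show ?thesis by (rule central_quasicyclic.is_comm_group)
qed

end
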